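(* Let $G$ be a finite simple graph on $k$ vertices labeled $1,\dots,k$. Let $\mathcal{B}_{2k}$ be the set of set partitions of $[2k]=\{1,\dots,2k\}$, of size $B_{2k}$ (the Bell number), listed in some fixed order, and let $d_G$ be the tree-counting vector indexed by $\mathcal B_{2k}$ defined in the context. Then there exist a $B_{2k}\times B_{2k}$ matrix $M$ and a vector $v$ of length $B_{2k}$ (depending only on $G$) such that for all $n\ge 3$, the number of spanning trees of the Cartesian product $G\times C_n$ equals $(M^n v)\cdot d_G$, where $C_n$ is the cycle on $n$ vertices and $\cdot$ is the dot product.
   Context: The Cartesian product $G\times H$ has vertex set $V(G)\times V(H)$, with $(a,b)$ adjacent to $(a',b')$ iff either $a=a'$ and $bb'\in E(H)$, or $b=b'$ and $aa'\in E(G)$. Write vertices of $G\times P_n$ and $G\times C_n$ (same vertex set) as $(i,j)$, $i\in[k]$, $j\in[n]$; $G\times C_n$ is obtained from $G\times P_n$ by adding the $k$ edges $\{(i,1),(i,n)\}$, $i\in[k]$. For a spanning forest $\mathcal F$ of $G\times P_n$, the partition of $[2k]$ induced by $\mathcal F$ is given by $a\sim b$ iff $w_a,w_b$ lie in the same tree of $\mathcal F$, where $w_i=(i,1)$ and $w_{k+i}=(i,n)$ for $i\in[k]$. $\mathcal F$ is cylindrically consistent with a partition $P$ of $[2k]$ if $\mathcal F$ has exactly $|P|$ trees and $P$ is the partition induced by $\mathcal F$. The tree-counting vector $d_G$ has, at partition $P$, the number of subsets $S$ of the added edges $\{(i,1),(i,n)\}$, $i\in[k]$, such that adding $S$ to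 a forest cylindrically consistent with $P$ yields a spanning tree of $G\times C_n$ (this number depends only on $P$, not on $n$ or the forest). *)

theory Defs
  imports "Jordan_Normal_Form.Matrix" "HOL-Library.Disjoint_Sets"
begin

(* Edges are two-element sets of vertices.  In a symmetric digraph, as used in Graph_Theory,
   the two arcs of a single edge already form a cycle, so forest and spanning_tree defined there
   are not the undirected notions. *)
record 'a ugraph =
  vertices :: "'a set"
  edges :: "'a set set"

definition simple_graph :: "'a ugraph \<Rightarrow> bool" where
  "simple_graph G \<longleftrightarrow>
     finite (vertices G) \<and> (\<forall>e\<in>edges G. e \<subseteq> vertices G \<and> card e = 2)"

definition joined :: "'a ugraph \<Rightarrow> 'a \<Rightarrow> 'a \<Rightarrow> bool" where
  "joined G u v \<longleftrightarrow>
     u \<in> vertices G \<and> v \<in> vertices G \<and> (u, v) \<in> {(x, y). {x, y} \<in> edges G}\<^sup>*"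

definition connected_graph :: "'a ugraph \<Rightarrow> bool" where
  "connected_graph G \<longleftrightarrow>
     vertices G \<noteq> {} \<and> (\<forall>u\<in>vertices G. \<forall>v\<in>vertices G. joined G u v)"

definition is_cycle :: "'a ugraph \<Rightarrow> 'a list \<Rightarrow> bool" where
  "is_cycle G vs \<longleftrightarrow>
     3 \<le> length vs \<and> distinct vs \<and>
     (\<forall>i<length vs. {vs ! i, vs ! (Suc i mod length vs)} \<in> edges G)"

definition is_forest :: "'a ugraph \<Rightarrow> bool" where
  "is_forest G \<longleftrightarrow> simple_graph G \<and> \<not> (\<exists>vs. is_cycle G vs)"

definition is_tree :: "'a ugraph \<Rightarrow> bool" where
  "is_tree G \<longleftrightarrow> is_forest G \<and> connected_graph G"

definition spanning_subgraph :: "'a ugraph \<Rightarrow> 'a ugraph \<Rightarrow> bool" where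
  "spanning_subgraph H G \<longleftrightarrow> vertices H = vertices G \<and> edges H \<subseteq> edges G"

definition spanning_forest :: "'a ugraph \<Rightarrow> 'a ugraph \<Rightarrow> bool" where
  "spanning_forest F G \<longleftrightarrow> spanning_subgraph F G \<and> is_forest F"

definition spanning_tree :: "'a ugraph \<Rightarrow> 'a ugraph \<Rightarrow> bool" where
  "spanning_tree T G \<longleftrightarrow> spanning_subgraph T G \<and> is_tree T"

definition num_spanning_trees :: "'a ugraph \<Rightarrow> nat" where
  "num_spanning_trees G = card {T. spanning_tree T G}"

definition component_sets :: "'a ugraph \<Rightarrow> 'a set set" where
  "component_sets G = vertices G // {(u, v). joined G u v}"

definition path_graph :: "nat \<Rightarrow> nat ugraph" where
  "path_graph n = \<lparr>vertices = {1..n}, edges = {{j, Suc j} |j. 1 \<le> j \<and> j < n}\<rparr>"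

(* The cycle on n vertices for n at least 3; not meant to be used for smaller n. *)
definition cycle_graph :: "nat \<Rightarrow> nat ugraph" where
  "cycle_graph n = \<lparr>vertices = {1..n}, edges = insert {1, n} (edges (path_graph n))\<rparr>"

definition cart_prod :: "'a ugraph \<Rightarrow> 'b ugraph \<Rightarrow> ('a \<times> 'b) ugraph" where
  "cart_prod G H =
     \<lparr>vertices = vertices G \<times> vertices H,
      edges = {{(a, b), (a', b')} |a b a' b'.
                 a = a' \<and> a \<in> vertices G \<and> {b, b'} \<in> edges H \<or>
                 b = b' \<and> b \<in> vertices H \<and> {a, a'} \<in> edges G}\<rparr>"

definition added_edges :: "nat \<Rightarrow> nat \<Rightarrow> (nat \<times> nat) set set" where
  "added_edges k n = {{(i, 1), (i, n)} |i. i \<in> {1..k}}"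

definition set_partitions :: "nat \<Rightarrow> nat set set set" where
  "set_partitions m = {P. partition_on {1..m} P}"

definition Bell :: "nat \<Rightarrow> nat" where
  "Bell m = card (set_partitions m)"

definition boundary_vertex :: "nat \<Rightarrow> nat \<Rightarrow> nat \<Rightarrow> nat \<times> nat" where
  "boundary_vertex k n a = (if a \<le> k then (a, 1) else (a - k, n))"

definition induced_partition :: "nat \<Rightarrow> nat \<Rightarrow> (nat \<times> nat) ugraph \<Rightarrow> nat set set" where
  "induced_partition k n F =
     {1..2 * k} // {(a, b). a \<in> {1..2 * k} \<and> b \<in> {1..2 * k} \<and>
                            joined F (boundary_vertex k n a) (boundary_vertex k n b)}"

definition cyl_consistent ::
  "nat ugraph \<Rightarrow> nat \<Rightarrow> nat \<Rightarrow> (nat \<times> nat) ugraph \<Rightarrow> nat set set \<Rightarrow> bool" where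
  "cyl_consistent G k n F P \<longleftrightarrow>
     spanning_forest F (cart_prod G (path_graph n)) \<and>
     card (component_sets F) = card P \<and>
     induced_partition k n F = P"

definition num_completions :: "nat ugraph \<Rightarrow> nat \<Rightarrow> nat \<Rightarrow> (nat \<times> nat) ugraph \<Rightarrow> nat" where
  "num_completions G k n F =
     card {S. S \<subseteq> added_edges k n \<and>
              spanning_tree (F\<lparr>edges := edges F \<union> S\<rparr>) (cart_prod G (cycle_graph n))}"

(* The common value of num_completions over all n and all forests consistent with P.  Where no
   forest is consistent with P the value is unspecified by this description and is fixed to be 0. *)
definition tree_count :: "nat ugraph \<Rightarrow> nat \<Rightarrow> nat set set \<Rightarrow> nat" where
  "tree_count G k P =
     (if \<exists>n\<ge>3. \<exists>F. cyl_consistent G k n F P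
      then THE c. \<forall>n\<ge>3. \<forall>F. cyl_consistent G k n F P \<longrightarrow> num_completions G k n F = c
      else 0)"

definition tree_counting_vector :: "nat ugraph \<Rightarrow> nat \<Rightarrow> nat set set list \<Rightarrow> int vec" where
  "tree_counting_vector G k Ps = vec (length Ps) (\<lambda>i. int (tree_count G k (Ps ! i)))"

end

theory Submission
  imports Defs
begin

text \<open>
  Build \<open>G \<times> P\<^sub>n\<close> by alternately adding a set of rungs to a new layer and a copy of \<open>G\<close> in that
  layer.  Whether the union of a forest \<open>F\<close> with a set of new edges at the boundary is a forest, whether
  all its trees reach the new boundary, and which partition it induces there depend only on the
  partition induced by \<open>F\<close>.  So each of the two operations, and the final closing of the cylinder, acts
  on forest counts by a matrix: \<open>f (n + 1) = A B f n\<close> and \<open>f 1 = A e\<close>, where \<open>e\<close> is the unit vector at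
  the partition pairing \<open>i\<close> with \<open>k + i\<close>.  On the span of the partial pairings the rung matrix \<open>B\<close> is
  unitriangular, so \<open>e = B v\<close> for an integral \<open>v\<close>, and \<open>f n = (A B)\<^sup>n v\<close>.  A spanning tree of
  \<open>G \<times> C\<^sub>n\<close> is a closed-up forest inducing the one-block partition.
\<close>

section \<open>Acyclicity relative to a relation\<close>

text \<open>The obstacle is the exponent. Counting layers gives \<open>f n\<close> as the (n-1)-st
  power of A B applied to A e, whereas an n-th power applied to one vector is wanted, so e has to be
  pulled back through B, a step backwards without combinatorial meaning. B need not be inverted on
  all partitions. It sends the unit vector at the pairing of K to the sum of the unit vectors at the
  pairings of all subsets of K, which is the zeta matrix of the Boolean lattice. By Moebius
  inversion one preimage of e is the sum over L of (-1)^(k-|L|) times the unit vector at the pairing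
  of L; so v counts nothing and may have negative entries. The vector e describes a single layer
  without edges, where w_i and w_{k+i} are the same vertex. Demanding exactly |P| trees means that
  every tree meets the boundary. This condition survives each step, because a tree that loses
  contact with the boundary can never be joined to the rest later.\<close>

definition arcs :: "'a set set \<Rightarrow> ('a \<times> 'a) set" where
  "arcs E = {(x, y). {x, y} \<in> E}"

definition conn :: "('a \<times> 'a) set \<Rightarrow> 'a set set \<Rightarrow> ('a \<times> 'a) set" where
  "conn R E = (R \<union> arcs E)\<^sup>*"

text \<open>For an equivalence R this says that E becomes a forest when the classes of R are
  contracted: every edge is a bridge. Edges that become parallel after contraction remain different
  elements of E, so no multigraphs are needed.\<close>

definition acyclic_mod :: "('a \<times> 'a) set \<Rightarrow> 'a set set \<Rightarrow> bool" where
  "acyclic_mod R E \<longleftrightarrow> (\<forall>x y. {x, y} \<in> E \<longrightarrow> (x, y) \<notin> conn R (E - {{x, y}}))"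

lemma sym_arcs: "sym (arcs E)"
  by (auto simp: sym_def arcs_def insert_commute)

lemma sym_conn: "sym R \<Longrightarrow> sym (conn R E)"
  unfolding conn_def by (intro sym_rtrancl sym_Un sym_arcs)

lemma conn_commute: "sym R \<Longrightarrow> (x, y) \<in> conn R E \<Longrightarrow> (y, x) \<in> conn R E"
  using sym_conn[of R E] by (auto dest: symD)

lemma conn_refl [simp]: "(x, x) \<in> conn R E"
  by (simp add: conn_def)

lemma conn_trans: "(x, y) \<in> conn R E \<Longrightarrow> (y, z) \<in> conn R E \<Longrightarrow> (x, z) \<in> conn R E"
  unfolding conn_def by (rule rtrancl_trans)

lemma conn_mono: "R \<subseteq> R' \<Longrightarrow> E \<subseteq> E' \<Longrightarrow> conn R E \<subseteq> conn R' E'"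
  unfolding conn_def arcs_def by (intro rtrancl_mono) auto

lemma conn_edge: "{x, y} \<in> E \<Longrightarrow> (x, y) \<in> conn R E"
  unfolding conn_def arcs_def by auto

lemma conn_base: "(x, y) \<in> R \<Longrightarrow> (x, y) \<in> conn R E"
  unfolding conn_def by auto

lemma arcs_Un: "arcs (A \<union> B) = arcs A \<union> arcs B"
  by (auto simp: arcs_def)

lemma conn_conn: "conn (conn R E) E' = conn R (E \<union> E')"
  by (simp add: conn_def arcs_Un rtrancl_Un_rtrancl flip: Un_assoc)
    (metis rtrancl_Un_rtrancl rtrancl_idemp Un_assoc)

text \<open>A walk needs the new edge at most once: a second crossing either returns to an endpoint
  already reached without that edge or can be skipped, by symmetry.\<close>

lemma conn_insert_cases:
  assumes "sym R" "(x, y) \<in> conn R (insert {a, b} E)"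
  shows "(x, y) \<in> conn R E \<or> ((x, a) \<in> conn R E \<and> (b, y) \<in> conn R E) \<or>
    ((x, b) \<in> conn R E \<and> (a, y) \<in> conn R E)"
  using assms(2) unfolding conn_def[of R "insert {a, b} E"]
proof (induction rule: rtrancl_induct)
  case base
  then show ?case by simp
next
  case (step y z)
  show ?case
  proof (cases "(y, z) \<in> R \<union> arcs E")
    case True
    then have "(y, z) \<in> conn R E" by (auto simp: conn_def)
    with step.IH show ?thesis by (meson conn_trans)
  next
    case False
    then have "{y, z} = {a, b}" using step.hyps by (auto simp: arcs_def)
    then consider "y = a" "z = b" | "y = b" "z = a" by (auto simp: doubleton_eq_iff)
    then show ?thesis
    proof cases
      case 1
      then show ?thesis using step.IH conn_refl[of _ R E] by (metis conn_trans conn_commute[OF assms(1)])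
    next
      case 2
      then show ?thesis using step.IH conn_refl[of _ R E] by (metis conn_trans conn_commute[OF assms(1)])
    qed
  qed
qed

text \<open>This lets forests be built in stages: the earlier edges A enter the test for B only
  through the connectivity that they create.\<close>

lemma acyclic_mod_contract:
  assumes "sym R" "finite B" "A \<inter> B = {}" "\<And>e. e \<in> B \<Longrightarrow> card e = 2"
  shows "acyclic_mod R (A \<union> B) \<longleftrightarrow> acyclic_mod R A \<and> acyclic_mod (conn R A) B"
proof (intro iffI conjI)
  assume ac: "acyclic_mod R (A \<union> B)"
  show "acyclic_mod R A"
    unfolding acyclic_mod_def
  proof (intro allI impI)
    fix x y assume xy: "{x, y} \<in> A"
    have "conn R (A - {{x, y}}) \<subseteq> conn R (A \<union> B - {{x, y}})" by (rule conn_mono) auto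
    then show "(x, y) \<notin> conn R (A - {{x, y}})"
      using ac xy unfolding acyclic_mod_def by blast
  qed
  show "acyclic_mod (conn R A) B"
    unfolding acyclic_mod_def conn_conn
  proof (intro allI impI)
    fix x y assume xy: "{x, y} \<in> B"
    then have "A \<union> (B - {{x, y}}) = A \<union> B - {{x, y}}" using assms(3) by auto
    then show "(x, y) \<notin> conn R (A \<union> (B - {{x, y}}))"
      using ac xy unfolding acyclic_mod_def by (metis UnI2)
  qed
next
  assume "acyclic_mod R A \<and> acyclic_mod (conn R A) B"
  then have A: "acyclic_mod R A" and B: "acyclic_mod (conn R A) B" by auto
  show "acyclic_mod R (A \<union> B)"
    unfolding acyclic_mod_def
  proof (intro allI impI)
    fix x y assume xy: "{x, y} \<in> A \<union> B"
    show "(x, y) \<notin> conn R (A \<union> B - {{x, y}})"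
    proof (cases "{x, y} \<in> B")
      case True
      then have "A \<union> B - {{x, y}} = A \<union> (B - {{x, y}})" using assms(3) by auto
      then show ?thesis using B True unfolding acyclic_mod_def conn_conn by metis
    next
      case False
      with xy have xyA: "{x, y} \<in> A" by auto
      \<comment> \<open>An edge of A must remain a bridge when B is added. The edges of B are
        inserted one at a time, so that a first edge f joining x to y can be examined.\<close>
      have *: "(x, y) \<notin> conn R (A - {{x, y}} \<union> C)" if "C \<subseteq> B" for C
        using finite_subset[OF that assms(2)] that
      proof (induction C rule: finite_induct)
        case empty
        then show ?case using A xyA unfolding acyclic_mod_def by auto
      next
        case (insert f C)
        let ?E = "A - {{x, y}} \<union> C"
        from insert.prems assms(4) obtain a b where f: "f = {a, b}"
          by (meson card_2_iff insert_subset)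
        have notin: "(x, y) \<notin> conn R ?E" using insert by auto
        show ?case
        proof
          assume "(x, y) \<in> conn R (A - {{x, y}} \<union> insert f C)"
          then have "(x, y) \<in> conn R (insert {a, b} ?E)" by (simp add: f)
          from conn_insert_cases[OF assms(1) this] notin
          have c: "((x, a) \<in> conn R ?E \<and> (b, y) \<in> conn R ?E) \<or>
            ((x, b) \<in> conn R ?E \<and> (a, y) \<in> conn R ?E)" by auto
          have sub: "conn R ?E \<subseteq> conn R (A \<union> (B - {f}))"
            by (rule conn_mono) (use insert in auto)
          have xyc: "(x, y) \<in> conn R (A \<union> (B - {f}))" by (rule conn_edge) (use xyA in auto)
          \<comment> \<open>The edge {x, y}, together with the connections from its ends to a and b,
            bypasses f, although f is a bridge.\<close>
          have "(a, b) \<in> conn R (A \<union> (B - {f}))"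
            using c sub xyc by (meson subsetD conn_trans conn_commute[OF assms(1)])
          then show False
            using B insert.prems unfolding acyclic_mod_def conn_conn f by auto
        qed
      qed
      have "A \<union> B - {{x, y}} = A - {{x, y}} \<union> B" using False by auto
      then show ?thesis using *[of B] by auto
    qed
  qed
qed

section \<open>Cycles and bridges\<close>

lemma rtrancl_distinct_path:
  assumes "(x, y) \<in> r\<^sup>*"
  obtains vs where "vs \<noteq> []" "distinct vs" "hd vs = x" "last vs = y"
    "\<And>i. Suc i < length vs \<Longrightarrow> (vs ! i, vs ! Suc i) \<in> r"
proof -
  have "\<exists>vs. vs \<noteq> [] \<and> distinct vs \<and> hd vs = x \<and> last vs = y \<and>
    (\<forall>i. Suc i < length vs \<longrightarrow> (vs ! i, vs ! Suc i) \<in> r)"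
    using assms
  proof (induction rule: rtrancl_induct)
    case base
    show ?case by (rule exI[of _ "[x]"]) auto
  next
    case (step y z)
    then obtain vs where vs: "vs \<noteq> []" "distinct vs" "hd vs = x" "last vs = y"
      "\<And>i. Suc i < length vs \<Longrightarrow> (vs ! i, vs ! Suc i) \<in> r" by auto
    show ?case
    proof (cases "z \<in> set vs")
      case True
      then obtain m where m: "m < length vs" "vs ! m = z" by (auto simp: in_set_conv_nth)
      have "min (length vs) (Suc m) = Suc m" using m by simp
      then show ?thesis
        by (intro exI[of _ "take (Suc m) vs"])
          (use vs m in \<open>auto simp: hd_take last_conv_nth\<close>)
    next
      case False
      have "(vs ! i, z) \<in> r" if "Suc i = length vs" for i
        using \<open>(y, z) \<in> r\<close> vs that by (metis diff_Suc_1 last_conv_nth)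
      then show ?thesis
        by (intro exI[of _ "vs @ [z]"])
          (use vs False in \<open>auto simp: nth_append less_Suc_eq dest: Suc_lessI\<close>)
    qed
  qed
  then show thesis using that by blast
qed

text \<open>A cycle is an edge together with a path that joins its ends and avoids it. Cycles as
  vertex lists do not occur after this equivalence.\<close>

lemma is_forest_iff:
  "is_forest F \<longleftrightarrow> simple_graph F \<and> acyclic_mod {} (edges F)"
proof (cases "simple_graph F")
  case True
  have "(\<exists>vs. is_cycle F vs) \<longleftrightarrow> \<not> acyclic_mod {} (edges F)"
  proof
    assume "\<exists>vs. is_cycle F vs"
    then obtain vs where vs: "3 \<le> length vs" "distinct vs"
      "\<And>i. i < length vs \<Longrightarrow> {vs ! i, vs ! (Suc i mod length vs)} \<in> edges F"
      unfolding is_cycle_def by auto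
    define l where "l = length vs - 1"
    have l: "Suc l = length vs" "2 \<le> l" using vs(1) by (auto simp: l_def)
    let ?e = "{vs ! 0, vs ! l}"
    have "vs \<noteq> []" using vs(1) by auto
    have e: "?e \<in> edges F" using vs(3)[of l] l(1) by (auto simp: insert_commute)
    have "(vs ! 0, vs ! i) \<in> conn {} (edges F - {?e})" if "i \<le> l" for i
      using that
    proof (induction i)
      case (Suc i)
      have "{vs ! i, vs ! Suc i} \<in> edges F" using vs(3)[of i] Suc.prems l by auto
      \<comment> \<open>Length at least 3 matters here: with only two vertices, this edge would be
        the closing edge itself.\<close>
      moreover have "{vs ! i, vs ! Suc i} \<noteq> ?e"
        using vs(1,2) Suc.prems l \<open>vs \<noteq> []\<close> nth_eq_iff_index_eq[OF vs(2), of i 0]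
          nth_eq_iff_index_eq[OF vs(2), of "Suc i" l] nth_eq_iff_index_eq[OF vs(2), of "Suc i" 0]
        by (auto simp: doubleton_eq_iff)
      ultimately show ?case using Suc by (auto intro: conn_trans conn_edge)
    qed simp
    then show "\<not> acyclic_mod {} (edges F)" using e unfolding acyclic_mod_def by blast
  next
    assume "\<not> acyclic_mod {} (edges F)"
    then obtain x y where e: "{x, y} \<in> edges F" and c: "(x, y) \<in> (arcs (edges F - {{x, y}}))\<^sup>*"
      unfolding acyclic_mod_def conn_def by auto
    have neq: "x \<noteq> y" using True e by (auto simp: simple_graph_def)
    from rtrancl_distinct_path[OF c] obtain vs where vs: "vs \<noteq> []" "distinct vs" "hd vs = x" "last vs = y"
      "\<And>i. Suc i < length vs \<Longrightarrow> (vs ! i, vs ! Suc i) \<in> arcs (edges F - {{x, y}})" by metis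
    \<comment> \<open>A one-vertex path would give x = y, and a two-vertex path would use the
      removed edge.\<close>
    have len: "3 \<le> length vs"
    proof (rule ccontr)
      assume "\<not> 3 \<le> length vs"
      then have "length vs = Suc 0 \<or> length vs = Suc (Suc 0)"
        using vs(1) by (cases "length vs") auto
      then show False
        using vs neq by (auto simp: length_Suc_conv arcs_def)
    qed
    have "{vs ! i, vs ! (Suc i mod length vs)} \<in> edges F" if i: "i < length vs" for i
    proof (cases "Suc i < length vs")
      case True
      then show ?thesis using vs(5)[of i] by (auto simp: arcs_def)
    next
      case False
      then have "i = length vs - 1" "Suc i = length vs" using i by auto
      then have "vs ! i = y" "vs ! (Suc i mod length vs) = x"
        using vs by (auto simp: last_conv_nth hd_conv_nth)
      then show ?thesis using e by (simp add: insert_commute)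
    qed
    then show "\<exists>vs. is_cycle F vs" using vs(2) len unfolding is_cycle_def by auto
  qed
  then show ?thesis by (simp add: is_forest_def)
qed (simp add: is_forest_def)

section \<open>Pulling connectivity back along an indexing map\<close>

lemma conn_image_aux:
  assumes R: "refl R" "trans R"
    and xy: "(\<phi> a, y) \<in> conn R ((`) \<phi> ` D)" and a: "a \<in> J"
    and D: "\<And>e. e \<in> D \<Longrightarrow> e \<subseteq> J \<and> card e = 2"
  shows "\<exists>b\<in>J. (a, b) \<in> conn {(a, b). a \<in> J \<and> b \<in> J \<and> (\<phi> a, \<phi> b) \<in> R} D \<and> (\<phi> b, y) \<in> R"
  using xy unfolding conn_def[of R]
proof (induction rule: rtrancl_induct)
  case base
  then show ?case using a R(1) by (auto dest: reflD intro!: bexI[of _ a])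
next
  case (step y z)
  let ?R = "{(a, b). a \<in> J \<and> b \<in> J \<and> (\<phi> a, \<phi> b) \<in> R}"
  from step.IH obtain b where b: "b \<in> J" "(a, b) \<in> conn ?R D" "(\<phi> b, y) \<in> R" by auto
  from step.hyps consider "(y, z) \<in> R" | "{y, z} \<in> (`) \<phi> ` D" by (auto simp: arcs_def)
  then show ?case
  proof cases
    case 1
    then show ?thesis using b R(2) by (blast dest: transD)
  next
    case 2
    then obtain e where e: "e \<in> D" "{y, z} = \<phi> ` e" by auto
    from D[OF e(1)] have "e \<subseteq> J" "card e = 2" by auto
    then obtain c d where cd: "e = {c, d}" by (auto simp: card_2_iff)
    have "\<exists>c d. e = {c, d} \<and> y = \<phi> c \<and> z = \<phi> d"
      using e(2) cd by (auto simp: doubleton_eq_iff)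
    then obtain c d where cd: "e = {c, d}" "y = \<phi> c" "z = \<phi> d" by auto
    \<comment> \<open>The walk may leave the image of \<open>\<phi>\<close> between edges of D. Only
      the relation of \<open>\<phi> b\<close> to the current point y is kept, and this suffices for
      the pulled back relation to jump from b to the endpoint c.\<close>
    have "(b, c) \<in> ?R" using b cd \<open>e \<subseteq> J\<close> by auto
    then have "(a, d) \<in> conn ?R D" using b(2) e(1) cd
      by (blast intro: conn_trans conn_base conn_edge)
    then show ?thesis using cd \<open>e \<subseteq> J\<close> R(1) by (auto dest: reflD intro!: bexI[of _ d])
  qed
qed

text \<open>Here \<open>\<phi>\<close> may identify indices: as R is reflexive, two indices of the
  same vertex are related in the pullback. This occurs when the first and the last layer
  coincide.\<close>

lemma conn_image_iff:
  assumes R: "refl R" "trans R" and a: "a \<in> J" and b: "b \<in> J"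
    and D: "\<And>e. e \<in> D \<Longrightarrow> e \<subseteq> J \<and> card e = 2"
  shows "(\<phi> a, \<phi> b) \<in> conn R ((`) \<phi> ` D) \<longleftrightarrow>
    (a, b) \<in> conn {(a, b). a \<in> J \<and> b \<in> J \<and> (\<phi> a, \<phi> b) \<in> R} D" (is "_ \<longleftrightarrow> _ \<in> conn ?R D")
proof
  assume "(\<phi> a, \<phi> b) \<in> conn R ((`) \<phi> ` D)"
  from conn_image_aux[OF R this a D] obtain c where "c \<in> J" "(a, c) \<in> conn ?R D" "(\<phi> c, \<phi> b) \<in> R"
    by auto
  then show "(a, b) \<in> conn ?R D" using b by (blast intro: conn_trans conn_base)
next
  assume "(a, b) \<in> conn ?R D"
  then have "(a, b) \<in> (?R \<union> arcs D)\<^sup>*" by (simp add: conn_def)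
  then show "(\<phi> a, \<phi> b) \<in> conn R ((`) \<phi> ` D)"
  proof (induction rule: rtrancl_induct)
    case (step y z)
    have "(\<phi> y, \<phi> z) \<in> conn R ((`) \<phi> ` D)"
    proof (cases "(y, z) \<in> ?R")
      case True
      then show ?thesis by (auto intro: conn_base)
    next
      case False
      then have "{y, z} \<in> D" using step.hyps by (auto simp: arcs_def)
      then have "\<phi> ` {y, z} \<in> (`) \<phi> ` D" by (rule imageI)
      then show ?thesis by (auto intro: conn_edge)
    qed
    then show ?case using step.IH by (rule conn_trans[rotated])
  qed simp
qed

text \<open>Injectivity on the endpoints keeps different edges of D different, so deleting an edge
  commutes with taking images.\<close>

lemma acyclic_mod_image_iff:
  assumes R: "refl R" "trans R"
    and D: "\<And>e. e \<in> D \<Longrightarrow> e \<subseteq> J \<and> card e = 2" and inj: "inj_on \<phi> (\<Union>D)"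
  shows "acyclic_mod R ((`) \<phi> ` D) \<longleftrightarrow>
    acyclic_mod {(a, b). a \<in> J \<and> b \<in> J \<and> (\<phi> a, \<phi> b) \<in> R} D" (is "_ \<longleftrightarrow> acyclic_mod ?R D")
proof -
  have key: "(\<phi> a, \<phi> b) \<in> conn R ((`) \<phi> ` D - {\<phi> ` {a, b}}) \<longleftrightarrow> (a, b) \<in> conn ?R (D - {{a, b}})"
    if ab: "{a, b} \<in> D" for a b
  proof -
    have "inj_on ((`) \<phi>) D" using inj by (rule inj_on_image)
    then have "(`) \<phi> ` D - {\<phi> ` {a, b}} = (`) \<phi> ` (D - {{a, b}})"
      using ab by (simp add: inj_on_image_set_diff[where C = D])
    moreover have "(\<phi> a, \<phi> b) \<in> conn R ((`) \<phi> ` (D - {{a, b}})) \<longleftrightarrow> (a, b) \<in> conn ?R (D - {{a, b}})"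
      by (rule conn_image_iff) (use R D ab in auto)
    ultimately show ?thesis by simp
  qed
  show ?thesis
  proof
    assume l: "acyclic_mod R ((`) \<phi> ` D)"
    show "acyclic_mod ?R D"
      unfolding acyclic_mod_def
    proof (intro allI impI)
      fix a b assume ab: "{a, b} \<in> D"
      then have "\<phi> ` {a, b} \<in> (`) \<phi> ` D" by (rule imageI)
      then have "{\<phi> a, \<phi> b} \<in> (`) \<phi> ` D" by simp
      then show "(a, b) \<notin> conn ?R (D - {{a, b}})"
        using l key[OF ab] unfolding acyclic_mod_def by auto
    qed
  next
    assume r: "acyclic_mod ?R D"
    show "acyclic_mod R ((`) \<phi> ` D)"
      unfolding acyclic_mod_def
    proof (intro allI impI)
      fix x y assume "{x, y} \<in> (`) \<phi> ` D"
      then obtain e where e: "e \<in> D" "{x, y} = \<phi> ` e" by auto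
      obtain c d where cd: "e = {c, d}" using D[OF e(1)] by (auto simp: card_2_iff)
      have "\<exists>c d. e = {c, d} \<and> x = \<phi> c \<and> y = \<phi> d"
        using e(2) cd by (auto simp: doubleton_eq_iff)
      then obtain a b where ab: "e = {a, b}" "x = \<phi> a" "y = \<phi> b" by auto
      show "(x, y) \<notin> conn R ((`) \<phi> ` D - {{x, y}})"
        using r key[of a b] e(1) ab unfolding acyclic_mod_def by auto
    qed
  qed
qed

section \<open>Gluing edges along a boundary\<close>

definition same_block :: "'i set set \<Rightarrow> ('i \<times> 'i) set" where
  "same_block P = {(a, b). \<exists>p\<in>P. a \<in> p \<and> b \<in> p}"

text \<open>Consistency with P in a form suited to gluing: the global count of trees is replaced by
  the condition that every vertex reaches the boundary.\<close>

definition anchored :: "'v set \<Rightarrow> 'v set set \<Rightarrow> ('i \<Rightarrow> 'v) \<Rightarrow> 'i set \<Rightarrow> 'i set set \<Rightarrow> bool" where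
  "anchored V E w I P \<longleftrightarrow>
     (\<forall>e\<in>E. e \<subseteq> V \<and> card e = 2) \<and> acyclic_mod {} E \<and>
     (\<forall>v\<in>V. \<exists>a\<in>I. (v, w a) \<in> conn {} E) \<and>
     same_block P = {(a, b). a \<in> I \<and> b \<in> I \<and> (w a, w b) \<in> conn {} E}"

text \<open>\<open>J\<close> indexes the old boundary \<open>I\<close> together with the vertices that are added, and \<open>\<psi>\<close> sends the
  index of a new boundary vertex to its index in \<open>J\<close>.\<close>

definition glue_step ::
  "'i set \<Rightarrow> 'i set \<Rightarrow> ('i \<Rightarrow> 'i) \<Rightarrow> 'i set set \<Rightarrow> 'i set set \<Rightarrow> 'i set set \<Rightarrow> bool" where
  "glue_step I J \<psi> P D P' \<longleftrightarrow>
     acyclic_mod (same_block P) D \<and>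
     (\<forall>a\<in>J. \<exists>b\<in>I. (a, \<psi> b) \<in> conn (same_block P) D) \<and>
     same_block P' = {(a, b). a \<in> I \<and> b \<in> I \<and> (\<psi> a, \<psi> b) \<in> conn (same_block P) D}"

lemma same_block_inj:
  assumes "partition_on I P" "partition_on I Q" "same_block P = same_block Q"
  shows "P = Q"
proof -
  have "P = I // same_block P" "Q = I // same_block Q"
    unfolding same_block_def using assms(1,2)[THEN partition_on_eq_quotient, symmetric] .
  then show ?thesis using assms(3) by metis
qed

lemma same_block_quotient:
  assumes "equiv I r"
  shows "same_block (I // r) = r"
proof -
  have "(a, b) \<in> r" if "X \<in> I // r" "a \<in> X" "b \<in> X" for a b X
    using in_quotient_imp_in_rel[OF assms that(1)] that by auto
  moreover have "\<exists>X\<in>I // r. a \<in> X \<and> b \<in> X" if "(a, b) \<in> r" for a b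
  proof
    have "a \<in> I" using that assms by (auto elim: equivE)
    then show "r `` {a} \<in> I // r" "a \<in> r `` {a} \<and> b \<in> r `` {a}"
      using that equiv_class_self[OF assms, of a] by (auto intro: quotientI)
  qed
  ultimately show ?thesis by (auto simp: same_block_def)
qed

lemma quotient_eq_iff:
  assumes "equiv I r"
  shows "I // r = P \<longleftrightarrow> partition_on I P \<and> same_block P = r"
  using partition_on_quotient[OF assms] same_block_quotient[OF assms] same_block_inj by metis

lemma conn_outside:
  assumes "(x, y) \<in> conn {} E" "\<And>e. e \<in> E \<Longrightarrow> e \<subseteq> V"
  shows "x = y \<or> (x \<in> V \<and> y \<in> V)"
  using assms(1) unfolding conn_def
  by (induction rule: rtrancl_induct) (use assms(2) in \<open>auto simp: arcs_def\<close>)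

lemma equiv_conn_vimage: "equiv I {(a, b). a \<in> I \<and> b \<in> I \<and> (w a, w b) \<in> conn {} E}"
proof (rule equivI)
  show "sym {(a, b). a \<in> I \<and> b \<in> I \<and> (w a, w b) \<in> conn {} E}"
    using conn_commute[of "{}"] by (auto simp: sym_def)
  show "trans {(a, b). a \<in> I \<and> b \<in> I \<and> (w a, w b) \<in> conn {} E}"
    by (auto simp: trans_def intro: conn_trans)
qed (auto simp: refl_on_def)

lemma conn_Un_Id_on: "conn (R \<union> Id_on J) E = conn R E"
proof -
  have "R \<union> Id_on J \<union> arcs E \<subseteq> (R \<union> arcs E)\<^sup>*" by auto
  then show ?thesis unfolding conn_def by (intro rtrancl_subset[symmetric, THEN sym]) auto
qed

lemma acyclic_mod_Un_Id_on: "acyclic_mod (R \<union> Id_on J) E = acyclic_mod R E"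
  by (simp add: acyclic_mod_def conn_Un_Id_on)

text \<open>Pulled back to J, connectivity along E is \<open>same_block P\<close> up to the
  identity. Acyclicity, contact with the boundary and the induced partition of the glued graph can
  be read off this relation and D, so P is all that has to be remembered of E.\<close>

lemma anchored_glue:
  fixes \<phi> :: "'i \<Rightarrow> 'v"
  assumes IJ: "I \<subseteq> J" and \<phi>I: "\<phi> ` I \<subseteq> V" and inj: "inj_on \<phi> (J - I)"
    and new: "\<phi> ` (J - I) \<inter> V = {}" and \<psi>: "\<psi> ` I \<subseteq> J"
    and D: "finite D" "\<And>e. e \<in> D \<Longrightarrow> e \<subseteq> J \<and> card e = 2" and injD: "inj_on \<phi> (\<Union>D)"
    and E: "\<And>e. e \<in> E \<Longrightarrow> e \<subseteq> V" and disj: "E \<inter> (`) \<phi> ` D = {}"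
    and w: "\<And>a. a \<in> I \<Longrightarrow> w a = \<phi> a" and w': "\<And>a. a \<in> I \<Longrightarrow> w' a = \<phi> (\<psi> a)"
  shows "anchored (V \<union> \<phi> ` J) (E \<union> (`) \<phi> ` D) w' I P' \<longleftrightarrow>
    (\<exists>P. partition_on I P \<and> anchored V E w I P \<and> glue_step I J \<psi> P D P')"
proof -
  let ?X = "(`) \<phi> ` D"
  let ?R = "conn {} E"
  let ?RJ = "{(a, b). a \<in> J \<and> b \<in> J \<and> (\<phi> a, \<phi> b) \<in> ?R}"
  have refl: "refl ?R" and trans: "trans ?R" by (auto simp: conn_def refl_rtrancl trans_rtrancl)
  have symR: "sym ?R" by (rule sym_conn) auto
  have ac: "acyclic_mod {} (E \<union> ?X) \<longleftrightarrow> acyclic_mod {} E \<and> acyclic_mod ?RJ D"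
  proof -
    have "card e = 2" if "e \<in> ?X" for e
    proof -
      from that obtain d where d: "d \<in> D" "e = \<phi> ` d" by auto
      have "inj_on \<phi> d" by (rule inj_on_subset[OF injD]) (use d in auto)
      then show ?thesis using D(2)[OF d(1)] d(2) by (simp add: card_image)
    qed
    then have "acyclic_mod {} (E \<union> ?X) \<longleftrightarrow> acyclic_mod {} E \<and> acyclic_mod ?R ?X"
      by (intro acyclic_mod_contract) (use D disj in auto)
    also have "acyclic_mod ?R ?X \<longleftrightarrow> acyclic_mod ?RJ D"
      by (rule acyclic_mod_image_iff[OF refl trans D(2) injD])
    finally show ?thesis .
  qed
  have cn: "(\<phi> a, \<phi> b) \<in> conn {} (E \<union> ?X) \<longleftrightarrow> (a, b) \<in> conn ?RJ D" if "a \<in> J" "b \<in> J" for a b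
    using conn_image_iff[OF refl trans that D(2), of D \<phi>] by (simp add: conn_conn)
  have edges: "(\<forall>e\<in>E \<union> ?X. e \<subseteq> V \<union> \<phi> ` J \<and> card e = 2) \<longleftrightarrow> (\<forall>e\<in>E. e \<subseteq> V \<and> card e = 2)"
  proof -
    have "e \<subseteq> V \<union> \<phi> ` J \<and> card e = 2" if "e \<in> ?X" for e
    proof -
      from that obtain d where d: "d \<in> D" "e = \<phi> ` d" by auto
      have "inj_on \<phi> d" by (rule inj_on_subset[OF injD]) (use d in auto)
      then show ?thesis using D(2)[OF d(1)] d(2) by (auto simp: card_image)
    qed
    then show ?thesis using E by blast
  qed
  \<comment> \<open>Indices in J - I name vertices outside V, which no edge of E touches, so E
    relates them only to themselves.\<close>
  have RJ: "?RJ = {(a, b). a \<in> I \<and> b \<in> I \<and> (w a, w b) \<in> ?R} \<union> Id_on J"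
  proof -
    have "a = b \<or> (a \<in> I \<and> b \<in> I)" if "a \<in> J" "b \<in> J" "(\<phi> a, \<phi> b) \<in> ?R" for a b
    proof -
      from conn_outside[OF that(3) E] consider "\<phi> a \<in> V" "\<phi> b \<in> V" | "\<phi> a = \<phi> b" by auto
      then show ?thesis
      proof cases
        case 1
        then show ?thesis using that new by auto
      next
        case 2
        then show ?thesis using that new inj \<phi>I by (cases "a \<in> I"; cases "b \<in> I") (auto dest: inj_onD)
      qed
    qed
    moreover have "{(a, b). a \<in> I \<and> b \<in> I \<and> (w a, w b) \<in> ?R} =
        {(a, b). a \<in> I \<and> b \<in> I \<and> (\<phi> a, \<phi> b) \<in> ?R}"
      by (auto simp: w)
    ultimately show ?thesis using IJ by (auto simp: Id_on_def)
  qed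
  have touch: "(\<forall>v\<in>V \<union> \<phi> ` J. \<exists>a\<in>I. (v, w' a) \<in> conn {} (E \<union> ?X)) \<longleftrightarrow>
      (\<forall>v\<in>V. \<exists>a\<in>I. (v, w a) \<in> ?R) \<and> (\<forall>a\<in>J. \<exists>b\<in>I. (a, \<psi> b) \<in> conn ?RJ D)" (is "?L \<longleftrightarrow> ?A \<and> ?B")
  proof
    assume L: ?L
    have ?A
    proof
      fix v assume v: "v \<in> V"
      \<comment> \<open>The first glued edge on a walk from v starts at a vertex of V, whose index
        must lie in I. Hence a tree that misses the old boundary cannot reach the new one.\<close>
      have *: "(v, y) \<in> ?R \<or> (\<exists>a\<in>I. (v, w a) \<in> ?R)" if "(v, y) \<in> conn {} (E \<union> ?X)" for y
        using that[folded conn_conn] unfolding conn_def[of ?R]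
      proof (induction rule: rtrancl_induct)
        case (step y z)
        show ?case
        proof (cases "(v, y) \<in> ?R \<and> (y, z) \<notin> ?R")
          case True
          then have "{y, z} \<in> ?X" using step.hyps by (auto simp: arcs_def)
          then obtain e where e: "e \<in> D" "{y, z} = \<phi> ` e" by auto
          then obtain c where c: "c \<in> J" "y = \<phi> c" using D(2)[OF e(1)] by blast
          have "y \<in> V" using conn_outside[of v y E V] True v E by auto
          then have "c \<in> I" using c new by auto
          then show ?thesis using True c w by auto
        next
          case False
          then show ?thesis using step.IH conn_trans[of v y "{}" E z] by metis
        qed
      qed simp
      obtain a where a: "a \<in> I" "(v, w' a) \<in> conn {} (E \<union> ?X)" using L v by auto
      show "\<exists>a\<in>I. (v, w a) \<in> ?R"
      proof (cases "(v, w' a) \<in> ?R")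
        case True
        have "w' a \<in> V" using conn_outside[OF True E] v by auto
        then have "\<psi> a \<in> I" using a w' \<psi> new by auto
        then show ?thesis using True w w' a by auto
      next
        case False
        then show ?thesis using *[OF a(2)] by auto
      qed
    qed
    moreover have ?B
    proof
      fix a assume a: "a \<in> J"
      then obtain b where b: "b \<in> I" "(\<phi> a, w' b) \<in> conn {} (E \<union> ?X)" using L by auto
      then show "\<exists>b\<in>I. (a, \<psi> b) \<in> conn ?RJ D"
        using cn[of a "\<psi> b"] a \<psi> w' by auto
    qed
    ultimately show "?A \<and> ?B" ..
  next
    assume AB: "?A \<and> ?B"
    have J: "\<exists>b\<in>I. (\<phi> a, w' b) \<in> conn {} (E \<union> ?X)" if a: "a \<in> J" for a
    proof -
      obtain b where "b \<in> I" "(a, \<psi> b) \<in> conn ?RJ D" using AB a by auto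
      then show ?thesis using cn[of a "\<psi> b"] a \<psi> w' by auto
    qed
    have sub: "?R \<subseteq> conn {} (E \<union> ?X)" by (rule conn_mono) auto
    show ?L
    proof
      fix v assume "v \<in> V \<union> \<phi> ` J"
      then consider "v \<in> V" | a where "a \<in> J" "v = \<phi> a" by auto
      then show "\<exists>a\<in>I. (v, w' a) \<in> conn {} (E \<union> ?X)"
      proof cases
        case 1
        then obtain a where "a \<in> I" "(v, w a) \<in> ?R" using AB by auto
        then have "a \<in> J" "(v, \<phi> a) \<in> conn {} (E \<union> ?X)" using sub w IJ by auto
        then show ?thesis using J by (meson conn_trans)
      next
        case 2
        then show ?thesis using J by auto
      qed
    qed
  qed
  have ind: "{(a, b). a \<in> I \<and> b \<in> I \<and> (w' a, w' b) \<in> conn {} (E \<union> ?X)} =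
      {(a, b). a \<in> I \<and> b \<in> I \<and> (\<psi> a, \<psi> b) \<in> conn ?RJ D}"
    using cn w' \<psi> by (auto simp: image_subset_iff)
  let ?Q = "{(a, b). a \<in> I \<and> b \<in> I \<and> (w a, w b) \<in> ?R}"
  have Q: "partition_on I (I // ?Q)" "same_block (I // ?Q) = ?Q"
    using partition_on_quotient[OF equiv_conn_vimage] same_block_quotient[OF equiv_conn_vimage] .
  show ?thesis
  proof
    assume "anchored (V \<union> \<phi> ` J) (E \<union> ?X) w' I P'"
    \<comment> \<open>The witness for P is the partition that E itself induces.\<close>
    then have "anchored V E w I (I // ?Q) \<and> glue_step I J \<psi> (I // ?Q) D P'"
      unfolding anchored_def glue_step_def edges ac touch ind Q(2)
      by (simp add: RJ conn_Un_Id_on acyclic_mod_Un_Id_on)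
    then show "\<exists>P. partition_on I P \<and> anchored V E w I P \<and> glue_step I J \<psi> P D P'"
      using Q(1) by blast
  next
    assume "\<exists>P. partition_on I P \<and> anchored V E w I P \<and> glue_step I J \<psi> P D P'"
    then obtain P where P: "anchored V E w I P" "glue_step I J \<psi> P D P'" by auto
    have "same_block P = ?Q" using P(1) unfolding anchored_def by auto
    then show "anchored (V \<union> \<phi> ` J) (E \<union> ?X) w' I P'"
      using P unfolding anchored_def glue_step_def edges ac touch ind
      by (simp add: RJ conn_Un_Id_on acyclic_mod_Un_Id_on)
  qed
qed

lemma anchored_unique:
  "anchored V E w I P \<Longrightarrow> anchored V E w I Q \<Longrightarrow> partition_on I P \<Longrightarrow> partition_on I Q \<Longrightarrow> P = Q"
  unfolding anchored_def by (metis same_block_inj)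

text \<open>The gluing criterion becomes a matrix-vector product. A set F splits uniquely into its
  part in E and the image of a subset of D, and the part in E determines P, so the products of
  choices for different P are disjoint.\<close>

lemma card_anchored_glue:
  fixes \<phi> :: "'i \<Rightarrow> 'v"
  assumes I: "finite I" "I \<subseteq> J" and \<phi>I: "\<phi> ` I \<subseteq> V" and inj: "inj_on \<phi> (J - I)"
    and new: "\<phi> ` (J - I) \<inter> V = {}" and \<psi>: "\<psi> ` I \<subseteq> J"
    and D: "finite D" "\<And>e. e \<in> D \<Longrightarrow> e \<subseteq> J \<and> card e = 2" and injD: "inj_on \<phi> (\<Union>D)"
    and E: "finite E" "\<And>e. e \<in> E \<Longrightarrow> e \<subseteq> V" and disj: "E \<inter> (`) \<phi> ` D = {}"
    and w: "\<And>a. a \<in> I \<Longrightarrow> w a = \<phi> a" and w': "\<And>a. a \<in> I \<Longrightarrow> w' a = \<phi> (\<psi> a)"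
    and V': "V' = V \<union> \<phi> ` J" and E': "E' = E \<union> (`) \<phi> ` D"
  shows "card {F. F \<subseteq> E' \<and> anchored V' F w' I P'} =
    (\<Sum>P | partition_on I P. card {F. F \<subseteq> E \<and> anchored V F w I P} *
       card {B. B \<subseteq> D \<and> glue_step I J \<psi> P B P'})"
proof -
  let ?N = "\<lambda>P. {F. F \<subseteq> E \<and> anchored V F w I P} \<times> {B. B \<subseteq> D \<and> glue_step I J \<psi> P B P'}"
  let ?U = "\<lambda>(F, B). F \<union> (`) \<phi> ` B"
  have glue: "anchored V' (F \<union> (`) \<phi> ` B) w' I P' \<longleftrightarrow>
      (\<exists>P. partition_on I P \<and> anchored V F w I P \<and> glue_step I J \<psi> P B P')"
    if "F \<subseteq> E" "B \<subseteq> D" for F B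
    unfolding V'
  proof (rule anchored_glue[OF I(2) \<phi>I inj new \<psi>])
    show "finite B" using that D(1) finite_subset by auto
    show "inj_on \<phi> (\<Union>B)" by (rule inj_on_subset[OF injD]) (use that in auto)
    show "F \<inter> (`) \<phi> ` B = {}" using disj that by blast
    show "e \<subseteq> V" if "e \<in> F" for e using that \<open>F \<subseteq> E\<close> E(2) by blast
  qed (use that D w w' in auto)
  have injim: "inj_on ((`) \<phi>) D" using injD by (rule inj_on_image)
  have "{F. F \<subseteq> E' \<and> anchored V' F w' I P'} = ?U ` (\<Union>P\<in>{P. partition_on I P}. ?N P)"
  proof (intro equalityI subsetI)
    fix F assume "F \<in> {F. F \<subseteq> E' \<and> anchored V' F w' I P'}"
    then have F: "F \<subseteq> E \<union> (`) \<phi> ` D" "anchored V' F w' I P'" by (auto simp: E')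
    define A where "A = F \<inter> E"
    define B where "B = {d \<in> D. \<phi> ` d \<in> F}"
    have FAB: "F = A \<union> (`) \<phi> ` B" using F(1) by (auto simp: A_def B_def)
    have "A \<subseteq> E" "B \<subseteq> D" by (auto simp: A_def B_def)
    then show "F \<in> ?U ` (\<Union>P\<in>{P. partition_on I P}. ?N P)"
      using glue[of A B] F(2) FAB by (auto intro!: image_eqI[of _ _ "(A, B)"])
  next
    fix F assume "F \<in> ?U ` (\<Union>P\<in>{P. partition_on I P}. ?N P)"
    then obtain A B P where *: "F = A \<union> (`) \<phi> ` B" "partition_on I P" "A \<subseteq> E" "B \<subseteq> D"
      "anchored V A w I P" "glue_step I J \<psi> P B P'" by auto
    then have "anchored V' F w' I P'" using glue by blast
    then show "F \<in> {F. F \<subseteq> E' \<and> anchored V' F w' I P'}" using * by (auto simp: E')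
  qed
  moreover have "inj_on ?U (\<Union>P\<in>{P. partition_on I P}. ?N P)"
  proof (rule inj_onI)
    fix x y assume x: "x \<in> (\<Union>P\<in>{P. partition_on I P}. ?N P)"
      and y: "y \<in> (\<Union>P\<in>{P. partition_on I P}. ?N P)" and eq: "?U x = ?U y"
    obtain A B A' B' where [simp]: "x = (A, B)" "y = (A', B')" by (cases x; cases y)
    have sub: "A \<subseteq> E" "B \<subseteq> D" "A' \<subseteq> E" "B' \<subseteq> D" using x y by auto
    have u: "A \<union> (`) \<phi> ` B = A' \<union> (`) \<phi> ` B'" using eq by simp
    have split: "(C \<union> (`) \<phi> ` K) \<inter> E = C" "(C \<union> (`) \<phi> ` K) - E = (`) \<phi> ` K"
      if "C \<subseteq> E" "K \<subseteq> D" for C K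
    proof -
      have "(`) \<phi> ` K \<inter> E = {}" using that disj by auto
      then show "(C \<union> (`) \<phi> ` K) \<inter> E = C" "(C \<union> (`) \<phi> ` K) - E = (`) \<phi> ` K"
        using that(1) by auto
    qed
    have "A = A'" using split(1)[OF sub(1,2)] split(1)[OF sub(3,4)] u by simp
    moreover have "(`) \<phi> ` B = (`) \<phi> ` B'"
      using split(2)[OF sub(1,2)] split(2)[OF sub(3,4)] u by simp
    then have "B = B'" using inj_on_image_eq_iff[OF injim] sub by blast
    ultimately show "x = y" by simp
  qed
  ultimately have "card {F. F \<subseteq> E' \<and> anchored V' F w' I P'} =
      card (\<Union>P\<in>{P. partition_on I P}. ?N P)" by (simp add: card_image)
  also have "\<dots> = (\<Sum>P | partition_on I P. card (?N P))"
  proof (rule card_UN_disjoint)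
    show "finite {P. partition_on I P}" using I(1) by (rule finitely_many_partition_on)
    show "\<forall>P\<in>{P. partition_on I P}. finite (?N P)" using E D by auto
    show "\<forall>P\<in>{P. partition_on I P}. \<forall>Q\<in>{P. partition_on I P}. P \<noteq> Q \<longrightarrow> ?N P \<inter> ?N Q = {}"
      using anchored_unique by blast
  qed
  also have "\<dots> = (\<Sum>P | partition_on I P. card {F. F \<subseteq> E \<and> anchored V F w I P} *
       card {B. B \<subseteq> D \<and> glue_step I J \<psi> P B P'})"
    by (simp add: card_cartesian_product)
  finally show ?thesis .
qed

section \<open>Rungs acting on pairings\<close>

text \<open>With K = {1..k} this is the state of a single layer without edges; the smaller K arise
  from it when rungs are left out.\<close>

definition pairing :: "nat \<Rightarrow> nat set \<Rightarrow> nat set set" where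
  "pairing k K = (\<lambda>i. {i, k + i}) ` K \<union> (\<lambda>i. {i}) ` ({1..k} - K) \<union> (\<lambda>i. {k + i}) ` ({1..k} - K)"

definition rung_edges :: "nat \<Rightarrow> nat set \<Rightarrow> nat set set" where
  "rung_edges k C = (\<lambda>i. {k + i, 2 * k + i}) ` C"

text \<open>The indices up to 3k form three blocks: the first layer, the present last layer and the
  new layer. Rungs join the second block to the third, and the new boundary consists of the first
  and the third.\<close>

definition skip_middle :: "nat \<Rightarrow> nat \<Rightarrow> nat" where
  "skip_middle k a = (if a \<le> k then a else k + a)"

lemma partition_on_pairing:
  assumes "K \<subseteq> {1..k}"
  shows "partition_on {1..2 * k} (pairing k K)"
proof (rule partition_onI)
  show "\<Union> (pairing k K) = {1..2 * k}"
  proof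
    show "\<Union> (pairing k K) \<subseteq> {1..2 * k}" using assms by (auto simp: pairing_def)
    show "{1..2 * k} \<subseteq> \<Union> (pairing k K)"
    proof
      fix a assume a: "a \<in> {1..2 * k}"
      show "a \<in> \<Union> (pairing k K)"
      proof (cases "a \<le> k")
        case True
        then show ?thesis using a by (cases "a \<in> K") (auto simp: pairing_def)
      next
        case False
        then obtain i where "a = k + i" "i \<in> {1..k}"
          using a by (intro that[of "a - k"]) auto
        then show ?thesis by (cases "i \<in> K") (auto simp: pairing_def)
      qed
    qed
  qed
  have "k + i \<notin> K" if "i \<in> K" for i using subsetD[OF assms that] subsetD[OF assms, of "k + i"] by auto
  then show "disjnt p q" if "p \<in> pairing k K" "q \<in> pairing k K" "p \<noteq> q" for p q
    using that assms by (auto simp: pairing_def disjnt_def)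
qed (auto simp: pairing_def)

lemma same_block_pairing:
  assumes "K \<subseteq> {1..k}"
  shows "same_block (pairing k K) = {(a, b). a \<in> {1..2 * k} \<and> b \<in> {1..2 * k} \<and>
    (a = b \<or> (a \<in> K \<and> b = k + a) \<or> (b \<in> K \<and> a = k + b))}"
proof -
  have "(a, a) \<in> same_block (pairing k K)" if "a \<in> {1..2 * k}" for a
    using partition_onD1[OF partition_on_pairing[OF assms]] that by (auto simp: same_block_def)
  moreover have "(a, k + a) \<in> same_block (pairing k K)" "(k + a, a) \<in> same_block (pairing k K)"
    if "a \<in> K" for a
    using that by (auto simp: same_block_def pairing_def)
  moreover have "a \<in> {1..2 * k} \<and> b \<in> {1..2 * k} \<and>
    (a = b \<or> (a \<in> K \<and> b = k + a) \<or> (b \<in> K \<and> a = k + b))" if "(a, b) \<in> same_block (pairing k K)" for a b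
    using that assms unfolding same_block_def pairing_def by auto
  ultimately show ?thesis by blast
qed

text \<open>Labels the components of the graph with edges \<open>{i, k + i}\<close> for \<open>i \<in> K\<close> and
  \<open>{k + i, 2 * k + i}\<close> for \<open>i \<in> C\<close>.\<close>

definition rung_label :: "nat \<Rightarrow> nat set \<Rightarrow> nat set \<Rightarrow> nat \<Rightarrow> nat \<times> nat" where
  "rung_label k K C a =
     (if a \<le> k then (a, 0)
      else if a \<le> 2 * k then (a - k, if a - k \<in> K then 0 else 1)
      else (a - 2 * k, if a - 2 * k \<notin> C then 2 else if a - 2 * k \<in> K then 0 else 1))"

text \<open>An invariant of walks, used to show that vertices are not connected. The second
  coordinate tells whether the component contains i (0), k + i but not i (1), or neither
  (2).\<close>

lemma rung_label_eq:
  assumes "K \<subseteq> {1..k}" "C \<subseteq> {1..k}"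
    and "(a, b) \<in> conn (same_block (pairing k K)) (rung_edges k C)"
  shows "rung_label k K C a = rung_label k K C b"
  using assms(3) unfolding conn_def
proof (induction rule: rtrancl_induct)
  case (step y z)
  from step.hyps(2) consider "(y, z) \<in> same_block (pairing k K)" | "{y, z} \<in> rung_edges k C"
    by (auto simp: arcs_def)
  then have "rung_label k K C y = rung_label k K C z"
  proof cases
    case 1
    then show ?thesis using assms(1) unfolding same_block_pairing[OF assms(1)]
      by (auto simp: rung_label_def)
  next
    case 2
    then obtain i where i: "i \<in> C" "{y, z} = {k + i, 2 * k + i}" by (auto simp: rung_edges_def)
    moreover have "rung_label k K C (k + i) = rung_label k K C (2 * k + i)"
      using i(1) assms(2) by (auto simp: rung_label_def)
    ultimately show ?thesis by (auto simp: doubleton_eq_iff)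
  qed
  then show ?case using step.IH by simp
qed simp

text \<open>The columns i, k + i, 2k + i are independent paths, with the first link present for i in
  K and the second for i in C. No cycle can arise, the middle vertex reaches the new boundary if one
  link is present, and the ends are joined if both are.\<close>

lemma glue_step_pairing:
  assumes K: "K \<subseteq> {1..k}" and C: "C \<subseteq> {1..k}"
  shows "glue_step {1..2 * k} {1..3 * k} (skip_middle k) (pairing k K) (rung_edges k C) P \<longleftrightarrow>
    K \<union> C = {1..k} \<and> same_block P = same_block (pairing k (K \<inter> C))"
proof -
  let ?R = "same_block (pairing k K)"
  let ?c = "conn ?R (rung_edges k C)"
  have symR: "sym ?R" by (auto simp: sym_def same_block_def)
  have cK: "(i, k + i) \<in> ?c" if "i \<in> K" for i
    by (rule conn_base) (use that K in \<open>auto simp: same_block_pairing[OF K]\<close>)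
  have cC: "(k + i, 2 * k + i) \<in> ?c" if "i \<in> C" for i
    by (rule conn_edge) (use that in \<open>auto simp: rung_edges_def\<close>)
  have acyclic: "acyclic_mod ?R (rung_edges k C)"
    unfolding acyclic_mod_def
  proof (intro allI impI notI)
    fix x y assume xy: "{x, y} \<in> rung_edges k C"
      and c: "(x, y) \<in> conn ?R (rung_edges k C - {{x, y}})"
    obtain i where i: "i \<in> C" "{x, y} = {k + i, 2 * k + i}" using xy by (auto simp: rung_edges_def)
    have "rung_edges k C - {{x, y}} \<subseteq> rung_edges k (C - {i})"
      unfolding i(2) by (auto simp: rung_edges_def)
    then have "(x, y) \<in> conn ?R (rung_edges k (C - {i}))" using c conn_mono by blast
    then have "rung_label k K (C - {i}) x = rung_label k K (C - {i}) y"
      by (rule rung_label_eq[OF K, rotated]) (use C in auto)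
    then have "rung_label k K (C - {i}) (k + i) = rung_label k K (C - {i}) (2 * k + i)"
      using i(2) by (auto simp: doubleton_eq_iff)
    \<comment> \<open>Without rung i the vertex 2k + i is isolated, so its label has second
      coordinate 2.\<close>
    then show False using i(1) C by (auto simp: rung_label_def split: if_splits)
  qed
  have touch: "(\<forall>a\<in>{1..3 * k}. \<exists>b\<in>{1..2 * k}. (a, skip_middle k b) \<in> ?c) \<longleftrightarrow> K \<union> C = {1..k}"
  proof
    assume L: "\<forall>a\<in>{1..3 * k}. \<exists>b\<in>{1..2 * k}. (a, skip_middle k b) \<in> ?c"
    have "i \<in> K \<union> C" if i: "i \<in> {1..k}" for i
    proof -
      have "k + i \<in> {1..3 * k}" using i by auto
      then obtain b where b: "b \<in> {1..2 * k}" "(k + i, skip_middle k b) \<in> ?c" using L by blast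
      from rung_label_eq[OF K C b(2)] show ?thesis
        using i b(1) by (auto simp: rung_label_def skip_middle_def split: if_splits)
    qed
    then show "K \<union> C = {1..k}" using K C by blast
  next
    assume KC: "K \<union> C = {1..k}"
    show "\<forall>a\<in>{1..3 * k}. \<exists>b\<in>{1..2 * k}. (a, skip_middle k b) \<in> ?c"
    proof
      fix a assume a: "a \<in> {1..3 * k}"
      consider "a \<le> k" | i where "i \<in> {1..k}" "a = k + i" | i where "i \<in> {1..k}" "a = 2 * k + i"
      proof -
        assume *: "a \<le> k \<Longrightarrow> thesis" "\<And>i. i \<in> {1..k} \<Longrightarrow> a = k + i \<Longrightarrow> thesis"
          "\<And>i. i \<in> {1..k} \<Longrightarrow> a = 2 * k + i \<Longrightarrow> thesis"
        show thesis using a *(1) *(2)[of "a - k"] *(3)[of "a - 2 * k"] by force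
      qed
      then show "\<exists>b\<in>{1..2 * k}. (a, skip_middle k b) \<in> ?c"
      proof cases
        case 1
        then show ?thesis using a by (intro bexI[of _ a]) (auto simp: skip_middle_def)
      next
        case (2 i)
        show ?thesis
        proof (cases "i \<in> K")
          case True
          then show ?thesis using 2 conn_commute[OF symR cK[OF True]]
            by (intro bexI[of _ i]) (auto simp: skip_middle_def)
        next
          case False
          then have "i \<in> C" using KC 2 by auto
          from cC[OF this] show ?thesis using 2
            by (intro bexI[of _ "k + i"]) (auto simp: skip_middle_def mult_2 add.assoc)
        qed
      next
        case (3 i)
        then show ?thesis
          by (intro bexI[of _ "k + i"]) (auto simp: skip_middle_def mult_2 add.assoc)
      qed
    qed
  qed
  have ind: "{(a, b). a \<in> {1..2 * k} \<and> b \<in> {1..2 * k} \<and> (skip_middle k a, skip_middle k b) \<in> ?c} =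
      same_block (pairing k (K \<inter> C))" (is "?S = _")
  proof -
    have KC: "K \<inter> C \<subseteq> {1..k}" using K by auto
    have "(a, b) \<in> ?S \<longleftrightarrow> a \<in> {1..2 * k} \<and> b \<in> {1..2 * k} \<and>
        (a = b \<or> (a \<in> K \<inter> C \<and> b = k + a) \<or> (b \<in> K \<inter> C \<and> a = k + b))" (is "_ \<longleftrightarrow> ?T") for a b
    proof
      assume "(a, b) \<in> ?S"
      then have ab: "a \<in> {1..2 * k}" "b \<in> {1..2 * k}"
        and c: "(skip_middle k a, skip_middle k b) \<in> ?c" by auto
      from rung_label_eq[OF K C c] show ?T
        using ab by (auto simp: rung_label_def skip_middle_def split: if_splits)
    next
      have mid: "(skip_middle k i, skip_middle k (k + i)) \<in> ?c" if "i \<in> K \<inter> C" for i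
      proof -
        have "(i, 2 * k + i) \<in> ?c" using cK[of i] cC[of i] that by (auto intro: conn_trans)
        then show ?thesis using that K by (auto simp: skip_middle_def mult_2 add.assoc)
      qed
      assume ?T
      then show "(a, b) \<in> ?S"
        using mid[of a] conn_commute[OF symR mid[of b]] by auto
    qed
    then show ?thesis unfolding same_block_pairing[OF KC] by auto
  qed
  show ?thesis unfolding glue_step_def ind touch using acyclic by blast
qed

text \<open>Rungs outside K are forced, as the middle vertex would otherwise be cut off. Rungs
  inside K are free, and the set L of those chosen is the set of columns that stay paired.\<close>

lemma card_glue_step_pairing:
  assumes K: "K \<subseteq> {1..k}" and P: "partition_on {1..2 * k} P"
  shows "int (card {B. B \<subseteq> rung_edges k {1..k} \<and>
      glue_step {1..2 * k} {1..3 * k} (skip_middle k) (pairing k K) B P}) =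
    (\<Sum>L\<in>Pow K. if P = pairing k L then 1 else 0)"
proof -
  have inj: "inj_on (rung_edges k) (Pow {1..k})"
  proof (rule inj_onI)
    fix C D assume "rung_edges k C = rung_edges k D"
    moreover have "inj (\<lambda>i. {k + i, 2 * k + i})" by (auto simp: inj_def doubleton_eq_iff)
    ultimately show "C = D" unfolding rung_edges_def by (simp add: inj_image_eq_iff)
  qed
  let ?S = "{L \<in> Pow K. P = pairing k L}"
  have eq: "{B. B \<subseteq> rung_edges k {1..k} \<and>
      glue_step {1..2 * k} {1..3 * k} (skip_middle k) (pairing k K) B P} =
      (\<lambda>L. rung_edges k (L \<union> ({1..k} - K))) ` ?S" (is "?A = ?B")
  proof (intro equalityI subsetI)
    fix B assume B: "B \<in> ?A"
    then obtain C where C: "C \<subseteq> {1..k}" "B = rung_edges k C"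
      unfolding rung_edges_def by (auto simp: subset_image_iff)
    have *: "K \<union> C = {1..k}" "same_block P = same_block (pairing k (K \<inter> C))"
      using B unfolding C(2) using glue_step_pairing[OF K C(1)] by auto
    have "P = pairing k (K \<inter> C)"
      by (rule same_block_inj[OF P partition_on_pairing *(2)]) (use K in auto)
    moreover have "C = K \<inter> C \<union> ({1..k} - K)" using *(1) C(1) by auto
    ultimately show "B \<in> ?B" using C(2) by (auto intro!: image_eqI[of _ _ "K \<inter> C"])
  next
    fix B assume "B \<in> ?B"
    then obtain L where L: "L \<subseteq> K" "P = pairing k L" "B = rung_edges k (L \<union> ({1..k} - K))" by auto
    have "L \<union> ({1..k} - K) \<subseteq> {1..k}" using L K by auto
    moreover have "K \<inter> (L \<union> ({1..k} - K)) = L" "K \<union> (L \<union> ({1..k} - K)) = {1..k}" using L K by auto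
    ultimately have "glue_step {1..2 * k} {1..3 * k} (skip_middle k) (pairing k K) B P"
      unfolding L(2,3) by (subst glue_step_pairing[OF K]) auto
    moreover have "B \<subseteq> rung_edges k {1..k}" using L K by (auto simp: rung_edges_def)
    ultimately show "B \<in> ?A" by blast
  qed
  have "inj_on (\<lambda>L. rung_edges k (L \<union> ({1..k} - K))) ?S"
  proof (rule inj_onI)
    fix L M assume L: "L \<in> ?S" and M: "M \<in> ?S"
      and e: "rung_edges k (L \<union> ({1..k} - K)) = rung_edges k (M \<union> ({1..k} - K))"
    have "L \<union> ({1..k} - K) = M \<union> ({1..k} - K)"
      by (rule inj_onD[OF inj e]) (use L M K in auto)
    then show "L = M" using L M by blast
  qed
  then have "card ?A = card ?S" unfolding eq by (rule card_image)
  moreover have "finite (Pow K)" using K finite_subset by auto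
  ultimately show ?thesis by (simp add: sum.If_cases Int_def conj_commute)
qed

text \<open>Gluing on rungs is unitriangular on the span of the pairings, hence invertible there.\<close>

lemma exists_rung_preimage:
  assumes "K \<subseteq> {1..k}"
  shows "\<exists>u :: nat set set \<Rightarrow> int. \<forall>P. partition_on {1..2 * k} P \<longrightarrow>
    (\<Sum>Q | partition_on {1..2 * k} Q. u Q * int (card {B. B \<subseteq> rung_edges k {1..k} \<and>
      glue_step {1..2 * k} {1..3 * k} (skip_middle k) Q B P})) = (if P = pairing k K then 1 else 0)"
proof -
  let ?b = "\<lambda>Q P. int (card {B. B \<subseteq> rung_edges k {1..k} \<and>
      glue_step {1..2 * k} {1..3 * k} (skip_middle k) Q B P})"
  let ?Q = "{Q. partition_on {1..2 * k} Q}"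
  have finQ: "finite ?Q" by (rule finitely_many_partition_on) simp
  have "finite K" using assms finite_subset by auto
  then show ?thesis using assms
  proof (induction K rule: finite_psubset_induct)
    case (psubset K)
    have "\<forall>L\<in>Pow K - {K}. \<exists>u. \<forall>P. partition_on {1..2 * k} P \<longrightarrow>
        (\<Sum>Q\<in>?Q. u Q * ?b Q P) = (if P = pairing k L then 1 else 0)"
      using psubset by blast
    from bchoice[OF this] obtain U where U: "\<And>L P. L \<in> Pow K - {K} \<Longrightarrow>
        partition_on {1..2 * k} P \<Longrightarrow>
        (\<Sum>Q\<in>?Q. U L Q * ?b Q P) = (if P = pairing k L then 1 else 0)"
      by blast
    \<comment> \<open>The image of the pairing of K is that pairing plus those of all proper
      subsets; the preimages already found for the latter are subtracted.\<close>
    define u where "u = (\<lambda>Q. (if Q = pairing k K then 1 else 0) - (\<Sum>L\<in>Pow K - {K}. U L Q))"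
    have "(\<Sum>Q\<in>?Q. u Q * ?b Q P) = (if P = pairing k K then 1 else 0)"
      if P: "partition_on {1..2 * k} P" for P
    proof -
      have "(\<Sum>Q\<in>?Q. u Q * ?b Q P) = (\<Sum>Q\<in>?Q. if Q = pairing k K then ?b Q P else 0) -
          (\<Sum>Q\<in>?Q. \<Sum>L\<in>Pow K - {K}. U L Q * ?b Q P)"
        unfolding sum_subtractf[symmetric] u_def
        by (rule sum.cong) (auto simp: left_diff_distrib sum_distrib_right)
      also have "(\<Sum>Q\<in>?Q. if Q = pairing k K then ?b Q P else 0) = ?b (pairing k K) P"
        using finQ partition_on_pairing[OF psubset.prems] by (simp add: sum.delta)
      also have "\<dots> = (\<Sum>L\<in>Pow K. if P = pairing k L then 1 else 0)"
        by (rule card_glue_step_pairing[OF psubset.prems P])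
      also have "\<dots> = (if P = pairing k K then 1 else 0) +
          (\<Sum>L\<in>Pow K - {K}. if P = pairing k L then 1 else 0)"
        using psubset.hyps by (subst sum.remove[of _ K]) auto
      also have "(\<Sum>Q\<in>?Q. \<Sum>L\<in>Pow K - {K}. U L Q * ?b Q P) =
          (\<Sum>L\<in>Pow K - {K}. if P = pairing k L then 1 else 0)"
        by (subst sum.swap) (rule sum.cong[OF refl], rule U[OF _ P], assumption)
      finally show ?thesis by simp
    qed
    then show ?case by blast
  qed
qed

section \<open>Layers of the cylinder\<close>

lemma edges_cart_prod:
  assumes "\<And>e. e \<in> edges G \<Longrightarrow> card e = 2" "\<And>e. e \<in> edges H \<Longrightarrow> card e = 2"
  shows "edges (cart_prod G H) = (\<Union>a\<in>vertices G. (\<lambda>e. Pair a ` e) ` edges H) \<union>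
    (\<Union>b\<in>vertices H. (\<lambda>e. (\<lambda>a. (a, b)) ` e) ` edges G)" (is "?L = ?R")
proof (intro equalityI subsetI)
  fix e assume "e \<in> ?L"
  then obtain a b a' b' where e: "e = {(a, b), (a', b')}" and
    "a = a' \<and> a \<in> vertices G \<and> {b, b'} \<in> edges H \<or> b = b' \<and> b \<in> vertices H \<and> {a, a'} \<in> edges G"
    unfolding cart_prod_def by auto
  then consider "a = a'" "a \<in> vertices G" "{b, b'} \<in> edges H" |
    "b = b'" "b \<in> vertices H" "{a, a'} \<in> edges G" by auto
  then show "e \<in> ?R"
  proof cases
    case 1
    have "e = Pair a ` {b, b'}" using e 1 by auto
    then show ?thesis using 1 by blast
  next
    case 2
    have "e = (\<lambda>a. (a, b)) ` {a, a'}" using e 2 by auto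
    then show ?thesis using 2 by blast
  qed
next
  fix e assume "e \<in> ?R"
  then consider a f where "a \<in> vertices G" "f \<in> edges H" "e = Pair a ` f" |
    b f where "b \<in> vertices H" "f \<in> edges G" "e = (\<lambda>a. (a, b)) ` f" by blast
  then show "e \<in> ?L"
  proof cases
    case 1
    obtain b b' where "f = {b, b'}" using assms(2)[OF 1(2)] by (auto simp: card_2_iff)
    then show ?thesis using 1 unfolding cart_prod_def by auto
  next
    case 2
    obtain a a' where "f = {a, a'}" using assms(1)[OF 2(2)] by (auto simp: card_2_iff)
    then show ?thesis using 2 unfolding cart_prod_def by auto
  qed
qed

lemma card_eq_image_iff:
  assumes "\<And>a b. a \<in> I \<Longrightarrow> b \<in> I \<Longrightarrow> f a = f b \<longleftrightarrow> g a = g b"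
  shows "card (f ` I) = card (g ` I)"
proof -
  have h: "g (inv_into I f (f a)) = g a" if "a \<in> I" for a
    using assms[of "inv_into I f (f a)" a] that by (simp add: f_inv_into_f inv_into_into)
  have "bij_betw (\<lambda>x. g (inv_into I f x)) (f ` I) (g ` I)"
    unfolding bij_betw_def
  proof
    show "inj_on (\<lambda>x. g (inv_into I f x)) (f ` I)"
      using assms by (auto simp: inj_on_def h)
    show "(\<lambda>x. g (inv_into I f x)) ` f ` I = g ` I"
      unfolding image_image by (rule image_cong) (auto simp: h)
  qed
  then show ?thesis by (rule bij_betw_same_card)
qed

text \<open>The classes on I inject into the classes on V, so for finite V equal cardinality means
  that this injection is onto: every class meets the image of w.\<close>

lemma card_quotient_eq_iff:
  assumes "finite V" "equiv V r" "w ` I \<subseteq> V"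
  shows "card (V // r) = card (I // {(a, b). a \<in> I \<and> b \<in> I \<and> (w a, w b) \<in> r}) \<longleftrightarrow>
    (\<forall>v\<in>V. \<exists>a\<in>I. (v, w a) \<in> r)"
proof -
  let ?q = "{(a, b). a \<in> I \<and> b \<in> I \<and> (w a, w b) \<in> r}"
  let ?S = "(\<lambda>a. r `` {w a}) ` I"
  have q: "equiv I ?q"
    using assms(2,3) unfolding equiv_def refl_on_def sym_def trans_def image_subset_iff by blast
  have "card ((\<lambda>a. ?q `` {a}) ` I) = card ?S"
  proof (rule card_eq_image_iff)
    fix a b assume ab: "a \<in> I" "b \<in> I"
    then show "?q `` {a} = ?q `` {b} \<longleftrightarrow> r `` {w a} = r `` {w b}"
      using eq_equiv_class_iff[OF q ab] eq_equiv_class_iff[OF assms(2), of "w a" "w b"] assms(3)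
      by auto
  qed
  moreover have "I // ?q = (\<lambda>a. ?q `` {a}) ` I" by (auto simp: quotient_def)
  ultimately have card: "card (I // ?q) = card ?S" by simp
  have sub: "?S \<subseteq> V // r" using assms(3) by (auto intro: quotientI)
  have fin: "finite (V // r)" using assms(1,2) by (auto intro: finite_quotient elim: equivE)
  have "card (V // r) = card ?S \<longleftrightarrow> V // r = ?S"
    using card_subset_eq[OF fin sub] by metis
  also have "\<dots> \<longleftrightarrow> (\<forall>v\<in>V. \<exists>a\<in>I. (v, w a) \<in> r)"
  proof
    assume eq: "V // r = ?S"
    show "\<forall>v\<in>V. \<exists>a\<in>I. (v, w a) \<in> r"
    proof
      fix v assume v: "v \<in> V"
      then have "r `` {v} \<in> ?S" unfolding eq[symmetric] by (rule quotientI)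
      then obtain a where "a \<in> I" "r `` {v} = r `` {w a}" by auto
      then show "\<exists>a\<in>I. (v, w a) \<in> r" using eq_equiv_class_iff[OF assms(2) v] assms(3) by blast
    qed
  next
    assume t: "\<forall>v\<in>V. \<exists>a\<in>I. (v, w a) \<in> r"
    have "V // r \<subseteq> ?S"
    proof
      fix X assume "X \<in> V // r"
      then obtain v where v: "v \<in> V" "X = r `` {v}" by (rule quotientE)
      then obtain a where "a \<in> I" "(v, w a) \<in> r" using t by auto
      then show "X \<in> ?S" using v equiv_class_eq[OF assms(2)] by auto
    qed
    then show "V // r = ?S" using sub by auto
  qed
  finally show ?thesis using card by simp
qed

lemma joined_iff: "joined F u v \<longleftrightarrow> u \<in> vertices F \<and> v \<in> vertices F \<and> (u, v) \<in> conn {} (edges F)"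
  by (simp add: joined_def conn_def arcs_def)

lemma simple_graph_cart_prod:
  assumes "simple_graph G" "simple_graph H"
  shows "simple_graph (cart_prod G H)"
proof -
  have G: "e \<subseteq> vertices G" "card e = 2" if "e \<in> edges G" for e
    using assms(1) that by (auto simp: simple_graph_def)
  have H: "e \<subseteq> vertices H" "card e = 2" if "e \<in> edges H" for e
    using assms(2) that by (auto simp: simple_graph_def)
  have V: "vertices (cart_prod G H) = vertices G \<times> vertices H" by (simp add: cart_prod_def)
  have "e \<subseteq> vertices G \<times> vertices H \<and> card e = 2" if "e \<in> edges (cart_prod G H)" for e
  proof -
    have "edges (cart_prod G H) = (\<Union>a\<in>vertices G. (\<lambda>e. Pair a ` e) ` edges H) \<union>
        (\<Union>b\<in>vertices H. (\<lambda>e. (\<lambda>a. (a, b)) ` e) ` edges G)" (is "_ = ?R")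
      by (rule edges_cart_prod) (use G H in auto)
    with that have "e \<in> ?R" by simp
    then consider a f where "a \<in> vertices G" "f \<in> edges H" "e = Pair a ` f" |
      b f where "b \<in> vertices H" "f \<in> edges G" "e = (\<lambda>a. (a, b)) ` f" by blast
    then show ?thesis
    proof cases
      case 1
      then show ?thesis using H[of f] by (auto simp: card_image inj_on_def)
    next
      case 2
      then show ?thesis using G[of f] by (auto simp: card_image inj_on_def)
    qed
  qed
  then show ?thesis using assms unfolding simple_graph_def V by auto
qed

lemma simple_path_graph: "simple_graph (path_graph n)"
  by (auto simp: simple_graph_def path_graph_def)

lemma simple_cycle_graph: "n \<ge> 3 \<Longrightarrow> simple_graph (cycle_graph n)"
  using simple_path_graph[of n] by (auto simp: simple_graph_def cycle_graph_def path_graph_def)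

lemma edges_path_graph_Suc:
  "n \<ge> 1 \<Longrightarrow> edges (path_graph (Suc n)) = insert {n, Suc n} (edges (path_graph n))"
  by (auto simp: path_graph_def less_Suc_eq)

lemma finite_edges: "simple_graph G \<Longrightarrow> finite (edges G)"
  unfolding simple_graph_def by (rule finite_subset[of _ "Pow (vertices G)"]) auto

lemma conn_empty: "conn {} {} = Id"
  by (auto simp: conn_def arcs_def)

section \<open>The product with a path, layer by layer\<close>

locale labelled_graph =
  fixes G :: "nat ugraph" and k :: nat
  assumes simple: "simple_graph G" and vertices: "vertices G = {1..k}" and pos: "0 < k"
begin

abbreviation I :: "nat set" where "I \<equiv> {1..2 * k}"

abbreviation V :: "nat \<Rightarrow> (nat \<times> nat) set" where "V n \<equiv> {1..k} \<times> {1..n}"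

abbreviation path_edges :: "nat \<Rightarrow> (nat \<times> nat) set set" where
  "path_edges n \<equiv> edges (cart_prod G (path_graph n))"

definition rungs :: "nat \<Rightarrow> (nat \<times> nat) set set" where
  "rungs n = (\<lambda>i. {(i, n), (i, Suc n)}) ` {1..k}"

definition layer :: "nat \<Rightarrow> (nat \<times> nat) set set" where
  "layer n = (\<lambda>e. (\<lambda>a. (a, n)) ` e) ` edges G"

lemma edge: "e \<in> edges G \<Longrightarrow> e \<subseteq> {1..k} \<and> card e = 2"
  using simple vertices by (auto simp: simple_graph_def)

lemma path_edges_eq:
  "path_edges n = (\<Union>a\<in>{1..k}. (\<lambda>e. Pair a ` e) ` edges (path_graph n)) \<union> (\<Union>b\<in>{1..n}. layer b)"
proof -
  have "path_edges n = (\<Union>a\<in>vertices G. (\<lambda>e. Pair a ` e) ` edges (path_graph n)) \<union>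
    (\<Union>b\<in>vertices (path_graph n). (\<lambda>e. (\<lambda>a. (a, b)) ` e) ` edges G)"
    by (rule edges_cart_prod)
      (use simple simple_path_graph[of n] in \<open>auto simp: simple_graph_def\<close>)
  then show ?thesis by (simp add: layer_def vertices path_graph_def)
qed

lemma path_edges_1: "path_edges (Suc 0) = layer (Suc 0)"
  unfolding path_edges_eq by (simp add: path_graph_def)

lemma path_edges_Suc:
  assumes "n \<ge> 1"
  shows "path_edges (Suc n) = path_edges n \<union> rungs n \<union> layer (Suc n)"
proof -
  have "{1..Suc n} = insert (Suc n) {1..n}" by auto
  moreover have "(\<Union>a\<in>{1..k}. (\<lambda>e. Pair a ` e) ` edges (path_graph (Suc n))) =
      (\<Union>a\<in>{1..k}. (\<lambda>e. Pair a ` e) ` edges (path_graph n)) \<union> rungs n"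
    unfolding edges_path_graph_Suc[OF assms] rungs_def by auto
  ultimately show ?thesis unfolding path_edges_eq by auto
qed

lemma cycle_edges:
  assumes "n \<ge> 3"
  shows "edges (cart_prod G (cycle_graph n)) = path_edges n \<union> added_edges k n"
proof -
  have "edges (cart_prod G (cycle_graph n)) =
      (\<Union>a\<in>vertices G. (\<lambda>e. Pair a ` e) ` edges (cycle_graph n)) \<union>
      (\<Union>b\<in>vertices (cycle_graph n). (\<lambda>e. (\<lambda>a. (a, b)) ` e) ` edges G)"
    by (rule edges_cart_prod)
      (use simple simple_cycle_graph[OF assms] in \<open>auto simp: simple_graph_def\<close>)
  also have "\<dots> = path_edges n \<union> added_edges k n"
    unfolding path_edges_eq by (auto simp: layer_def vertices cycle_graph_def added_edges_def)
  finally show ?thesis .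
qed

lemma simple_path_prod: "simple_graph (cart_prod G (path_graph n))"
  using simple simple_path_graph by (rule simple_graph_cart_prod)

lemma vertices_path_prod: "vertices (cart_prod G (path_graph n)) = V n"
  by (simp add: cart_prod_def path_graph_def vertices)

lemma vertices_cycle_prod: "vertices (cart_prod G (cycle_graph n)) = V n"
  by (simp add: cart_prod_def cycle_graph_def vertices)

lemma path_edge: "e \<in> path_edges n \<Longrightarrow> e \<subseteq> V n \<and> card e = 2"
  using simple_path_prod[of n] by (auto simp: simple_graph_def vertices_path_prod)

lemma finite_path_edges: "finite (path_edges n)"
  using simple_path_prod by (rule finite_edges)

lemma path_edge_short:
  assumes "e \<in> path_edges n" "(a, b) \<in> e" "(a', b') \<in> e"
  shows "b' \<le> Suc b"
  using assms unfolding path_edges_eq by (auto simp: path_graph_def layer_def)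

lemma rungs_image:
  "(`) (\<lambda>a. if a \<le> 2 * k then boundary_vertex k n a else (a - 2 * k, Suc n)) ` rung_edges k {1..k} = rungs n"
  unfolding rung_edges_def rungs_def image_image
  by (intro image_cong) (auto simp: boundary_vertex_def)

definition last_layer_edges :: "nat set set" where
  "last_layer_edges = (`) ((+) k) ` edges G"

definition closing_edges :: "nat set set" where
  "closing_edges = (\<lambda>i. {i, k + i}) ` {1..k}"

lemma layer_image: "(`) (boundary_vertex k n) ` last_layer_edges = layer n"
  unfolding last_layer_edges_def layer_def image_image
proof (intro image_cong refl)
  fix e a assume "e \<in> edges G" "a \<in> e"
  then have "1 \<le> a" using edge[of e] by auto
  then show "boundary_vertex k n (k + a) = (a, n)" by (simp add: boundary_vertex_def)
qed

lemma closing_image: "(`) (boundary_vertex k n) ` closing_edges = added_edges k n"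
proof -
  have "added_edges k n = (\<lambda>i. {(i, 1), (i, n)}) ` {1..k}" by (auto simp: added_edges_def)
  then show ?thesis unfolding closing_edges_def image_image
    by (simp only:) (intro image_cong, auto simp: boundary_vertex_def)
qed

lemma last_layer_edge:
  assumes "e \<in> last_layer_edges"
  shows "e \<subseteq> {k<..2 * k} \<and> card e = 2"
proof -
  obtain f where f: "f \<in> edges G" "e = (+) k ` f" using assms by (auto simp: last_layer_edges_def)
  then show ?thesis using edge[of f] by (auto simp: card_image)
qed

lemma closing_edge: "e \<in> closing_edges \<Longrightarrow> e \<subseteq> I \<and> card e = 2"
  using pos by (auto simp: closing_edges_def)

lemma rung_edge: "e \<in> rung_edges k {1..k} \<Longrightarrow> e \<subseteq> {k<..3 * k} \<and> card e = 2"
  by (auto simp: rung_edges_def)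

lemma boundary_in_V: "1 \<le> n \<Longrightarrow> boundary_vertex k n ` I \<subseteq> V n"
  by (auto simp: boundary_vertex_def)

lemma inj_boundary: "2 \<le> n \<Longrightarrow> inj_on (boundary_vertex k n) I"
  by (auto simp: inj_on_def boundary_vertex_def split: if_splits)

text \<open>All edges up to layer n together with the rungs to a bare layer n + 1. At n = 0 only the
  bare first layer is present, which lets the step that fills a layer cover the first layer
  too.\<close>

definition half_edges :: "nat \<Rightarrow> (nat \<times> nat) set set" where
  "half_edges n = (if n = 0 then {} else path_edges n \<union> rungs n)"

definition full_count :: "nat \<Rightarrow> nat set set \<Rightarrow> nat" where
  "full_count n P = card {F. F \<subseteq> path_edges n \<and> anchored (V n) F (boundary_vertex k n) I P}"

definition half_count :: "nat \<Rightarrow> nat set set \<Rightarrow> nat" where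
  "half_count n P =
     card {F. F \<subseteq> half_edges n \<and> anchored (V (Suc n)) F (boundary_vertex k (Suc n)) I P}"

definition layer_steps :: "nat set set \<Rightarrow> nat set set \<Rightarrow> nat" where
  "layer_steps P Q = card {B. B \<subseteq> last_layer_edges \<and> glue_step I I id P B Q}"

definition rung_steps :: "nat set set \<Rightarrow> nat set set \<Rightarrow> nat" where
  "rung_steps P Q =
     card {B. B \<subseteq> rung_edges k {1..k} \<and> glue_step I {1..3 * k} (skip_middle k) P B Q}"

text \<open>The entry of d_G at P, computed on boundary indices alone, whenever some forest on at
  least 3 layers is consistent with P.\<close>

definition closings :: "nat set set \<Rightarrow> nat" where
  "closings P = card {B. B \<subseteq> closing_edges \<and> glue_step I I id P B {I}}"

text \<open>The third block of indices names the vertices of the new layer. For n = 1 the first two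
  blocks name the same vertices; this is harmless, as injectivity is required only on the new
  indices and on the endpoints of rungs.\<close>

lemma half_count_step:
  assumes "n \<ge> 1"
  shows "half_count n Q = (\<Sum>P | partition_on I P. full_count n P * rung_steps P Q)"
  unfolding half_count_def full_count_def rung_steps_def
proof (rule card_anchored_glue[where
      \<phi> = "\<lambda>a. if a \<le> 2 * k then boundary_vertex k n a else (a - 2 * k, Suc n)"])
  let ?\<phi> = "\<lambda>a. if a \<le> 2 * k then boundary_vertex k n a else (a - 2 * k, Suc n)"
  have new: "?\<phi> ` ({1..3 * k} - I) = {1..k} \<times> {Suc n}"
  proof (intro equalityI subsetI)
    fix x assume "x \<in> {1..k} \<times> {Suc n}"
    then show "x \<in> ?\<phi> ` ({1..3 * k} - I)"
      by (intro image_eqI[of _ _ "2 * k + fst x"]) auto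
  qed auto
  have old: "?\<phi> ` I \<subseteq> V n" using boundary_in_V[OF assms] by auto
  then show "?\<phi> ` I \<subseteq> V n" .
  show "?\<phi> ` ({1..3 * k} - I) \<inter> V n = {}" unfolding new by auto
  show "inj_on ?\<phi> ({1..3 * k} - I)" by (auto simp: inj_on_def)
  show "skip_middle k ` I \<subseteq> {1..3 * k}" by (auto simp: skip_middle_def)
  show "finite (rung_edges k {1..k})" by (simp add: rung_edges_def)
  show "e \<subseteq> {1..3 * k} \<and> card e = 2" if "e \<in> rung_edges k {1..k}" for e
    using rung_edge[OF that] by auto
  show "inj_on ?\<phi> (\<Union> (rung_edges k {1..k}))"
    by (auto simp: inj_on_def rung_edges_def boundary_vertex_def)
  show "path_edges n \<inter> (`) ?\<phi> ` rung_edges k {1..k} = {}"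
    unfolding rungs_image using path_edge[of _ n] by (fastforce simp: rungs_def)
  show "boundary_vertex k (Suc n) a = ?\<phi> (skip_middle k a)" if "a \<in> I" for a
    using that by (auto simp: boundary_vertex_def skip_middle_def)
  have "?\<phi> ` {1..3 * k} = ?\<phi> ` I \<union> ?\<phi> ` ({1..3 * k} - I)"
    unfolding image_Un[symmetric] by (rule arg_cong[of _ _ "(`) ?\<phi>"]) auto
  then have "V n \<union> ?\<phi> ` {1..3 * k} = V n \<union> {1..k} \<times> {Suc n}" unfolding new using old by auto
  also have "\<dots> = V (Suc n)" by auto
  finally show "V (Suc n) = V n \<union> ?\<phi> ` {1..3 * k}" ..
  show "half_edges n = path_edges n \<union> (`) ?\<phi> ` rung_edges k {1..k}"
    unfolding rungs_image using assms by (simp add: half_edges_def)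
qed (use finite_path_edges path_edge in auto)

text \<open>Filling a layer adds no vertices, hence J = I and \<open>\<psi>\<close> is the identity.
  The case n = 0 is included and fills the bare first layer.\<close>

lemma full_count_step:
  "full_count (Suc n) Q = (\<Sum>P | partition_on I P. half_count n P * layer_steps P Q)"
  unfolding half_count_def full_count_def layer_steps_def
proof (rule card_anchored_glue[where \<phi> = "boundary_vertex k (Suc n)"])
  \<comment> \<open>Each edge present so far has an endpoint below layer n + 1, so it differs from
    all edges of the new layer.\<close>
  have half: "e \<subseteq> V (Suc n) \<and> \<not> e \<subseteq> {1..k} \<times> {Suc n}" if "e \<in> half_edges n" for e
  proof -
    from that have "n \<noteq> 0" "e \<in> path_edges n \<or> e \<in> rungs n"
      by (auto simp: half_edges_def split: if_splits)
    then show ?thesis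
    proof (elim disjE)
      assume e: "e \<in> path_edges n"
      then have "e \<noteq> {}" using path_edge[of e n] by auto
      then show ?thesis using path_edge[OF e] by fastforce
    next
      assume "e \<in> rungs n"
      then show ?thesis using \<open>n \<noteq> 0\<close> by (auto simp: rungs_def)
    qed
  qed
  show "e \<subseteq> V (Suc n)" if "e \<in> half_edges n" for e using half[OF that] ..
  show "half_edges n \<inter> (`) (boundary_vertex k (Suc n)) ` last_layer_edges = {}"
    unfolding layer_image
  proof -
    have "e \<subseteq> {1..k} \<times> {Suc n}" if "e \<in> layer (Suc n)" for e
      using that edge by (fastforce simp: layer_def)
    then show "half_edges n \<inter> layer (Suc n) = {}" using half by blast
  qed
  show "finite (half_edges n)" using finite_path_edges by (simp add: half_edges_def rungs_def)
  show "finite last_layer_edges" using finite_edges[OF simple] by (simp add: last_layer_edges_def)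
  show "e \<subseteq> I \<and> card e = 2" if "e \<in> last_layer_edges" for e
    using last_layer_edge[OF that] by auto
  have "inj_on (boundary_vertex k (Suc n)) {k<..2 * k}"
    by (auto simp: inj_on_def boundary_vertex_def)
  then show "inj_on (boundary_vertex k (Suc n)) (\<Union> last_layer_edges)"
    by (rule inj_on_subset) (use last_layer_edge in blast)
  show "boundary_vertex k (Suc n) ` I \<subseteq> V (Suc n)" by (rule boundary_in_V) simp
  then show "V (Suc n) = V (Suc n) \<union> boundary_vertex k (Suc n) ` I" by blast
  show "path_edges (Suc n) = half_edges n \<union> (`) (boundary_vertex k (Suc n)) ` last_layer_edges"
    unfolding layer_image
    by (cases "n = 0") (simp_all add: half_edges_def path_edges_1 path_edges_Suc)
qed auto

text \<open>In a bare single layer, i and k + i name the same vertex and nothing else is joined.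
  This is the vector e.\<close>

lemma half_count_0:
  assumes "partition_on I P"
  shows "half_count 0 P = (if P = pairing k {1..k} then 1 else 0)"
proof -
  have eq: "{(a, b). a \<in> I \<and> b \<in> I \<and> boundary_vertex k 1 a = boundary_vertex k 1 b} =
      same_block (pairing k {1..k})" (is "?L = _")
    unfolding same_block_pairing[OF subset_refl]
    by (auto simp: boundary_vertex_def split: if_splits)
  have "anchored (V 1) {} (boundary_vertex k 1) I P \<longleftrightarrow> same_block P = ?L"
  proof -
    have "\<exists>a\<in>I. v = boundary_vertex k 1 a" if "v \<in> V 1" for v
      using that by (intro bexI[of _ "fst v"]) (auto simp: boundary_vertex_def)
    then show ?thesis by (auto simp: anchored_def acyclic_mod_def conn_empty)
  qed
  also have "\<dots> \<longleftrightarrow> P = pairing k {1..k}"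
    unfolding eq using same_block_inj[OF assms partition_on_pairing[of "{1..k}"]] by auto
  finally have "{F. F \<subseteq> half_edges 0 \<and> anchored (V (Suc 0)) F (boundary_vertex k (Suc 0)) I P} =
      (if P = pairing k {1..k} then {{}} else {})"
    by (auto simp: half_edges_def)
  then show ?thesis by (simp add: half_count_def)
qed

end

section \<open>Closing the cylinder\<close>

context labelled_graph
begin

text \<open>Given the induced partition P, having |P| trees means that no tree misses the boundary,
  by \<open>card_quotient_eq_iff\<close>.\<close>

lemma cyl_consistent_iff:
  assumes "n \<ge> 1"
  shows "cyl_consistent G k n F P \<longleftrightarrow> vertices F = V n \<and> edges F \<subseteq> path_edges n \<and>
    partition_on I P \<and> anchored (V n) (edges F) (boundary_vertex k n) I P"
proof (cases "vertices F = V n \<and> edges F \<subseteq> path_edges n")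
  case True
  then have VF: "vertices F = V n" and EF: "\<And>e. e \<in> edges F \<Longrightarrow> e \<subseteq> V n \<and> card e = 2"
    using path_edge by auto
  let ?w = "boundary_vertex k n"
  let ?r = "{(u, v). u \<in> V n \<and> v \<in> V n \<and> (u, v) \<in> conn {} (edges F)}"
  let ?q = "{(a, b). a \<in> I \<and> b \<in> I \<and> (?w a, ?w b) \<in> conn {} (edges F)}"
  have simpleF: "simple_graph F" using VF EF by (auto simp: simple_graph_def)
  have w: "?w ` I \<subseteq> V n" using boundary_in_V[OF assms] .
  have r: "equiv (V n) ?r" using equiv_conn_vimage[of "V n" "\<lambda>x. x" "edges F"] .
  have q: "{(a, b). a \<in> I \<and> b \<in> I \<and> (?w a, ?w b) \<in> ?r} = ?q" using w by auto
  have comp: "component_sets F = V n // ?r"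
    unfolding component_sets_def joined_iff VF ..
  have "{(a, b). a \<in> I \<and> b \<in> I \<and> joined F (?w a) (?w b)} = ?q"
    unfolding joined_iff VF using w by blast
  then have ind: "induced_partition k n F = I // ?q" unfolding induced_partition_def by simp
  have part: "I // ?q = P \<longleftrightarrow> partition_on I P \<and> same_block P = ?q"
    by (rule quotient_eq_iff[OF equiv_conn_vimage])
  have touch: "card (V n // ?r) = card (I // ?q) \<longleftrightarrow>
      (\<forall>v\<in>V n. \<exists>a\<in>I. (v, ?w a) \<in> conn {} (edges F))"
  proof -
    have "card (V n // ?r) = card (I // ?q) \<longleftrightarrow> (\<forall>v\<in>V n. \<exists>a\<in>I. (v, ?w a) \<in> ?r)"
      by (rule card_quotient_eq_iff[OF _ r w, unfolded q]) simp
    also have "\<dots> \<longleftrightarrow> (\<forall>v\<in>V n. \<exists>a\<in>I. (v, ?w a) \<in> conn {} (edges F))"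
    proof (intro ball_cong bex_cong refl)
      fix v a assume "v \<in> V n" "a \<in> I"
      moreover from this have "?w a \<in> V n" using w by blast
      ultimately show "(v, ?w a) \<in> ?r \<longleftrightarrow> (v, ?w a) \<in> conn {} (edges F)"
        by (simp only: mem_Collect_eq case_prod_conv simp_thms)
    qed
    finally show ?thesis .
  qed
  have "cyl_consistent G k n F P \<longleftrightarrow>
      acyclic_mod {} (edges F) \<and> card (V n // ?r) = card P \<and> I // ?q = P"
    unfolding cyl_consistent_def spanning_forest_def spanning_subgraph_def is_forest_iff
      vertices_path_prod comp ind using True simpleF by blast
  also have "\<dots> \<longleftrightarrow>
      acyclic_mod {} (edges F) \<and> card (V n // ?r) = card (I // ?q) \<and> I // ?q = P"
    by (cases "I // ?q = P") (simp_all only: simp_thms)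
  finally have "cyl_consistent G k n F P \<longleftrightarrow> acyclic_mod {} (edges F) \<and>
      (\<forall>v\<in>V n. \<exists>a\<in>I. (v, ?w a) \<in> conn {} (edges F)) \<and> partition_on I P \<and> same_block P = ?q"
    unfolding touch part .
  then show ?thesis using True EF unfolding anchored_def by blast
next
  case False
  then show ?thesis
    unfolding cyl_consistent_def spanning_forest_def spanning_subgraph_def vertices_path_prod
    by blast
qed

text \<open>Connectedness splits into two conditions: every vertex reaches the boundary, and the
  boundary forms one block. As k > 0, there is a boundary vertex to reach.\<close>

lemma spanning_tree_iff:
  assumes "n \<ge> 3"
  shows "spanning_tree T (cart_prod G (cycle_graph n)) \<longleftrightarrow> vertices T = V n \<and>
    edges T \<subseteq> path_edges n \<union> added_edges k n \<and>
    anchored (V n) (edges T) (boundary_vertex k n) I {I}"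
proof (cases "vertices T = V n \<and> edges T \<subseteq> path_edges n \<union> added_edges k n")
  case True
  have "simple_graph (cart_prod G (cycle_graph n))"
    using simple simple_cycle_graph[OF assms] by (rule simple_graph_cart_prod)
  then have ET: "\<And>e. e \<in> edges T \<Longrightarrow> e \<subseteq> V n \<and> card e = 2"
    using True unfolding simple_graph_def vertices_cycle_prod cycle_edges[OF assms] by auto
  let ?w = "boundary_vertex k n"
  let ?c = "conn {} (edges T)"
  have w: "?w ` I \<subseteq> V n" using boundary_in_V assms by auto
  have "simple_graph T" using True ET by (auto simp: simple_graph_def)
  moreover have "connected_graph T \<longleftrightarrow>
      (\<forall>v\<in>V n. \<exists>a\<in>I. (v, ?w a) \<in> ?c) \<and> same_block {I} = {(a, b). a \<in> I \<and> b \<in> I \<and> (?w a, ?w b) \<in> ?c}"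
  proof -
    have "connected_graph T \<longleftrightarrow> (\<forall>u\<in>V n. \<forall>v\<in>V n. (u, v) \<in> ?c)"
      using True assms pos by (auto simp: connected_graph_def joined_iff)
    also have "\<dots> \<longleftrightarrow> (\<forall>v\<in>V n. \<exists>a\<in>I. (v, ?w a) \<in> ?c) \<and> (\<forall>a\<in>I. \<forall>b\<in>I. (?w a, ?w b) \<in> ?c)"
    proof
      assume *: "\<forall>u\<in>V n. \<forall>v\<in>V n. (u, v) \<in> ?c"
      have "1 \<in> I" using pos by auto
      then show "(\<forall>v\<in>V n. \<exists>a\<in>I. (v, ?w a) \<in> ?c) \<and> (\<forall>a\<in>I. \<forall>b\<in>I. (?w a, ?w b) \<in> ?c)"
        using * w unfolding image_subset_iff by blast
    next
      assume *: "(\<forall>v\<in>V n. \<exists>a\<in>I. (v, ?w a) \<in> ?c) \<and> (\<forall>a\<in>I. \<forall>b\<in>I. (?w a, ?w b) \<in> ?c)"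
      show "\<forall>u\<in>V n. \<forall>v\<in>V n. (u, v) \<in> ?c"
      proof (intro ballI)
        fix u v assume "u \<in> V n" "v \<in> V n"
        then obtain a b where ab: "a \<in> I" "b \<in> I" "(u, ?w a) \<in> ?c" "(v, ?w b) \<in> ?c"
          using * by blast
        then have "(?w a, ?w b) \<in> ?c" using * by blast
        moreover have "(?w b, v) \<in> ?c" using ab(4) by (rule conn_commute[rotated]) (simp add: sym_def)
        ultimately show "(u, v) \<in> ?c" using ab(3) by (metis conn_trans)
      qed
    qed
    also have "(\<forall>a\<in>I. \<forall>b\<in>I. (?w a, ?w b) \<in> ?c) \<longleftrightarrow>
        same_block {I} = {(a, b). a \<in> I \<and> b \<in> I \<and> (?w a, ?w b) \<in> ?c}"
      unfolding same_block_def by blast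
    finally show ?thesis .
  qed
  ultimately show ?thesis
    using True ET
    unfolding spanning_tree_def spanning_subgraph_def is_tree_def is_forest_iff
      vertices_cycle_prod cycle_edges[OF assms] anchored_def by blast
next
  case False
  then show ?thesis
    unfolding spanning_tree_def spanning_subgraph_def vertices_cycle_prod cycle_edges[OF assms]
    by blast
qed

text \<open>Path edges span at most two consecutive layers. For n = 2 the added edges would already
  be rungs.\<close>

lemma path_edges_added_disjoint:
  assumes "n \<ge> 3"
  shows "path_edges n \<inter> added_edges k n = {}"
proof -
  have "{(i, 1), (i, n)} \<notin> path_edges n" for i
    using path_edge_short[of "{(i, 1), (i, n)}" n i 1 i n] assms by auto
  then show ?thesis by (auto simp: added_edges_def)
qed

lemma num_spanning_trees_eq:
  assumes "n \<ge> 3"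
  shows "num_spanning_trees (cart_prod G (cycle_graph n)) =
    (\<Sum>P | partition_on I P. full_count n P * closings P)"
proof -
  let ?A = "{F. F \<subseteq> path_edges n \<union> added_edges k n \<and> anchored (V n) F (boundary_vertex k n) I {I}}"
  have "{T. spanning_tree T (cart_prod G (cycle_graph n))} = (\<lambda>F. \<lparr>vertices = V n, edges = F\<rparr>) ` ?A"
  proof (intro equalityI subsetI)
    fix T :: "(nat \<times> nat) ugraph" assume "T \<in> {T. spanning_tree T (cart_prod G (cycle_graph n))}"
    then have "vertices T = V n" "edges T \<in> ?A" unfolding spanning_tree_iff[OF assms] by auto
    then show "T \<in> (\<lambda>F. \<lparr>vertices = V n, edges = F\<rparr>) ` ?A"
      by (intro image_eqI[of _ _ "edges T"]) auto
  qed (auto simp: spanning_tree_iff[OF assms])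
  then have "num_spanning_trees (cart_prod G (cycle_graph n)) = card ?A"
    unfolding num_spanning_trees_def by (simp add: card_image inj_on_def)
  also have "\<dots> = (\<Sum>P | partition_on I P. full_count n P * closings P)"
    unfolding full_count_def closings_def
  proof (rule card_anchored_glue[where \<phi> = "boundary_vertex k n"])
    show w: "boundary_vertex k n ` I \<subseteq> V n" using boundary_in_V assms by auto
    then show "V n = V n \<union> boundary_vertex k n ` I" by blast
    show "finite closing_edges" by (simp add: closing_edges_def)
    show "inj_on (boundary_vertex k n) (\<Union> closing_edges)"
      by (rule inj_on_subset[OF inj_boundary]) (use assms closing_edge in auto)
    show "path_edges n \<inter> (`) (boundary_vertex k n) ` closing_edges = {}"
      unfolding closing_image by (rule path_edges_added_disjoint[OF assms])
    show "path_edges n \<union> added_edges k n = path_edges n \<union> (`) (boundary_vertex k n) ` closing_edges"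
      unfolding closing_image ..
  qed (use finite_path_edges path_edge closing_edge in auto)
  finally show ?thesis .
qed

text \<open>This is the well-definedness of d_G. The criterion of \<open>anchored_glue\<close> asks
  for some partition induced by F; by \<open>anchored_unique\<close> it is P, after which neither n
  nor F remains.\<close>

lemma num_completions_eq:
  assumes n: "n \<ge> 3" and F: "cyl_consistent G k n F P"
  shows "num_completions G k n F = closings P"
proof -
  let ?w = "boundary_vertex k n"
  have "n \<ge> 1" using n by simp
  note F' = F[unfolded cyl_consistent_iff[OF this]]
  then have VF: "vertices F = V n" and EF: "edges F \<subseteq> path_edges n" and P: "partition_on I P"
    and anch: "anchored (V n) (edges F) ?w I P" by auto
  have inj: "inj_on ?w (\<Union> closing_edges)"
    by (rule inj_on_subset[OF inj_boundary]) (use n closing_edge in auto)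
  have glue: "spanning_tree (F\<lparr>edges := edges F \<union> (`) ?w ` B\<rparr>) (cart_prod G (cycle_graph n)) \<longleftrightarrow>
      glue_step I I id P B {I}" if B: "B \<subseteq> closing_edges" for B
  proof -
    have w: "V n = V n \<union> ?w ` I" using boundary_in_V[of n] n by auto
    have sub: "(`) ?w ` B \<subseteq> added_edges k n" unfolding closing_image[symmetric] using B by auto
    have "spanning_tree (F\<lparr>edges := edges F \<union> (`) ?w ` B\<rparr>) (cart_prod G (cycle_graph n)) \<longleftrightarrow>
        anchored (V n) (edges F \<union> (`) ?w ` B) ?w I {I}"
      unfolding spanning_tree_iff[OF n] using VF EF sub by auto
    also have "\<dots> \<longleftrightarrow> anchored (V n \<union> ?w ` I) (edges F \<union> (`) ?w ` B) ?w I {I}"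
      using w by simp
    also have "\<dots> \<longleftrightarrow>
        (\<exists>Q. partition_on I Q \<and> anchored (V n) (edges F) ?w I Q \<and> glue_step I I id Q B {I})"
    proof (rule anchored_glue)
      show "?w ` I \<subseteq> V n" using w by blast
      show "finite B" by (rule finite_subset[OF B]) (simp add: closing_edges_def)
      show "e \<subseteq> I \<and> card e = 2" if "e \<in> B" for e using that B closing_edge by blast
      show "inj_on ?w (\<Union> B)" by (rule inj_on_subset[OF inj]) (use B in auto)
      show "e \<subseteq> V n" if "e \<in> edges F" for e using that EF path_edge by blast
      show "edges F \<inter> (`) ?w ` B = {}" using EF sub path_edges_added_disjoint[OF n] by blast
    qed auto
    also have "\<dots> \<longleftrightarrow> glue_step I I id P B {I}" using anch P anchored_unique by blast
    finally show ?thesis .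
  qed
  have "{S. S \<subseteq> added_edges k n \<and>
      spanning_tree (F\<lparr>edges := edges F \<union> S\<rparr>) (cart_prod G (cycle_graph n))} =
      (\<lambda>B. (`) ?w ` B) ` {B. B \<subseteq> closing_edges \<and> glue_step I I id P B {I}}" (is "?L = ?f ` ?R")
  proof (intro equalityI subsetI)
    fix S assume S: "S \<in> ?L"
    then obtain B where "B \<subseteq> closing_edges" "S = (`) ?w ` B"
      unfolding closing_image[symmetric] by (auto simp: subset_image_iff)
    then show "S \<in> ?f ` ?R" using S glue by blast
  next
    fix S assume "S \<in> ?f ` ?R"
    then obtain B where B: "B \<subseteq> closing_edges" "glue_step I I id P B {I}" "S = (`) ?w ` B" by auto
    have "S \<subseteq> added_edges k n" unfolding closing_image[symmetric] B(3) using B(1) by auto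
    then show "S \<in> ?L" using B glue by blast
  qed
  moreover have "inj_on ?f ?R"
    by (rule inj_on_subset[of _ "Pow closing_edges"])
      (use inj_on_image[OF inj] inj_on_image[of "(`) ?w" "Pow closing_edges"] in \<open>auto\<close>)
  ultimately show ?thesis unfolding num_completions_def closings_def by (simp add: card_image)
qed

text \<open>A nonzero count supplies a consistent forest, so exactly one value satisfies the
  description in \<open>tree_count\<close>.\<close>

lemma tree_count_eq:
  assumes "n \<ge> 3" "partition_on I P" "full_count n P \<noteq> 0"
  shows "tree_count G k P = closings P"
proof -
  have "\<exists>F. F \<subseteq> path_edges n \<and> anchored (V n) F (boundary_vertex k n) I P"
    using assms(3) unfolding full_count_def by (metis (mono_tags, lifting) Collect_empty_eq card.empty)
  then obtain F where "F \<subseteq> path_edges n" "anchored (V n) F (boundary_vertex k n) I P" by auto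
  then have F: "cyl_consistent G k n \<lparr>vertices = V n, edges = F\<rparr> P"
    using assms by (subst cyl_consistent_iff) auto
  have "(THE c. \<forall>n\<ge>3. \<forall>F. cyl_consistent G k n F P \<longrightarrow> num_completions G k n F = c) = closings P"
  proof (rule the_equality)
    show "\<forall>n\<ge>3. \<forall>F. cyl_consistent G k n F P \<longrightarrow> num_completions G k n F = closings P"
      using num_completions_eq by blast
    show "c = closings P"
      if "\<forall>n\<ge>3. \<forall>F. cyl_consistent G k n F P \<longrightarrow> num_completions G k n F = c" for c
      using that F assms(1) num_completions_eq by metis
  qed
  then show ?thesis using F assms(1) unfolding tree_count_def by auto
qed

text \<open>Partitions without a consistent forest on n layers have coefficient 0, so the default
  value in \<open>tree_count\<close> does no harm.\<close>

lemma num_spanning_trees_tree_count: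
  assumes "n \<ge> 3"
  shows "num_spanning_trees (cart_prod G (cycle_graph n)) =
    (\<Sum>P | partition_on I P. full_count n P * tree_count G k P)"
  unfolding num_spanning_trees_eq[OF assms]
  using tree_count_eq[OF assms] by (intro sum.cong) auto

section \<open>The transfer matrix and its starting vector\<close>

lemma exists_transfer_matrix:
  assumes Ps: "distinct Ps" "set Ps = set_partitions (2 * k)"
  shows "\<exists>M \<in> carrier_mat (Bell (2 * k)) (Bell (2 * k)). \<exists>v \<in> carrier_vec (Bell (2 * k)).
    \<forall>n\<ge>1. (M ^\<^sub>m n) *\<^sub>v v = vec (length Ps) (\<lambda>i. int (full_count n (Ps ! i)))"
proof -
  let ?N = "length Ps"
  have N: "Bell (2 * k) = ?N" using Ps by (simp add: Bell_def flip: distinct_card)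
  have parts: "{P. partition_on I P} = set Ps" using Ps by (simp add: set_partitions_def)
  have part: "partition_on I (Ps ! i)" if "i < ?N" for i using that parts nth_mem by blast
  have sum_Ps: "(\<Sum>P | partition_on I P. f P) = (\<Sum>i<?N. f (Ps ! i))" for f :: "_ \<Rightarrow> int"
    unfolding parts using Ps(1) by (simp add: sum.distinct_set_conv_list sum_list_sum_nth atLeast0LessThan)
  \<comment> \<open>Rows are indexed by the new state and columns by the old one, since the matrices
    act on column vectors of counts.\<close>
  define A where "A = mat ?N ?N (\<lambda>(i, j). int (layer_steps (Ps ! j) (Ps ! i)))"
  define B where "B = mat ?N ?N (\<lambda>(i, j). int (rung_steps (Ps ! j) (Ps ! i)))"
  define f where "f n = vec ?N (\<lambda>i. int (full_count n (Ps ! i)))" for n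
  define h where "h n = vec ?N (\<lambda>i. int (half_count n (Ps ! i)))" for n
  have A: "A \<in> carrier_mat ?N ?N" and B: "B \<in> carrier_mat ?N ?N" by (auto simp: A_def B_def)
  have Ah: "A *\<^sub>v h n = f (Suc n)" for n
  proof (rule eq_vecI)
    fix i assume "i < dim_vec (f (Suc n))"
    then have i: "i < ?N" by (simp add: f_def)
    have "(A *\<^sub>v h n) $ i = (\<Sum>j<?N. int (half_count n (Ps ! j)) * int (layer_steps (Ps ! j) (Ps ! i)))"
      using i by (simp add: A_def h_def scalar_prod_def atLeast0LessThan mult.commute)
    also have "\<dots> = int (full_count (Suc n) (Ps ! i))"
      unfolding full_count_step by (simp add: sum_Ps del: One_nat_def)
    finally show "(A *\<^sub>v h n) $ i = f (Suc n) $ i" using i by (simp add: f_def)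
  qed (simp add: A_def f_def)
  have Bf: "B *\<^sub>v f n = h n" if "n \<ge> 1" for n
  proof (rule eq_vecI)
    fix i assume "i < dim_vec (h n)"
    then have i: "i < ?N" by (simp add: h_def)
    have "(B *\<^sub>v f n) $ i = (\<Sum>j<?N. int (full_count n (Ps ! j)) * int (rung_steps (Ps ! j) (Ps ! i)))"
      using i by (simp add: B_def f_def scalar_prod_def atLeast0LessThan mult.commute)
    also have "\<dots> = int (half_count n (Ps ! i))"
      unfolding half_count_step[OF that] by (simp add: sum_Ps del: One_nat_def)
    finally show "(B *\<^sub>v f n) $ i = h n $ i" using i by (simp add: h_def)
  qed (simp add: B_def h_def)
  obtain u :: "nat set set \<Rightarrow> int" where u: "\<And>P. partition_on I P \<Longrightarrow>
      (\<Sum>Q | partition_on I Q. u Q * int (rung_steps Q P)) = (if P = pairing k {1..k} then 1 else 0)"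
    using exists_rung_preimage[of "{1..k}" k] unfolding rung_steps_def by blast
  define v where "v = vec ?N (\<lambda>i. u (Ps ! i))"
  have v: "v \<in> carrier_vec ?N" by (simp add: v_def)
  have Bv: "B *\<^sub>v v = h 0"
  proof (rule eq_vecI)
    fix i assume "i < dim_vec (h 0)"
    then have i: "i < ?N" by (simp add: h_def)
    have "(B *\<^sub>v v) $ i = (\<Sum>j<?N. u (Ps ! j) * int (rung_steps (Ps ! j) (Ps ! i)))"
      using i by (simp add: B_def v_def scalar_prod_def atLeast0LessThan mult.commute)
    also have "\<dots> = int (half_count 0 (Ps ! i))"
      using u[OF part[OF i]] half_count_0[OF part[OF i]] by (simp add: sum_Ps del: One_nat_def)
    finally show "(B *\<^sub>v v) $ i = h 0 $ i" using i by (simp add: h_def)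
  qed (simp add: B_def h_def)
  \<comment> \<open>\<open>f 0\<close> describes no layer, so v stands in as a formal zeroth term: B
    maps it to the bare first layer \<open>h 0\<close>, and A maps that to
    \<open>f 1\<close>.\<close>
  define x where "x n = (if n = 0 then v else f n)" for n
  have x: "x n \<in> carrier_vec ?N" for n using v by (simp add: x_def f_def)
  have step: "(A * B) *\<^sub>v x n = x (Suc n)" for n
  proof -
    have "B *\<^sub>v x n = h n" using Bv Bf[of n] by (simp add: x_def)
    then show ?thesis
      using assoc_mult_mat_vec[OF A B x, of n] Ah[of n] by (simp add: x_def)
  qed
  have AB: "A * B \<in> carrier_mat ?N ?N" using A B by simp
  \<comment> \<open>The power is peeled off on the right, which shifts the starting index; hence the
    induction is over arbitrary m.\<close>
  have "((A * B) ^\<^sub>m n) *\<^sub>v x m = x (m + n)" for n m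
  proof (induction n arbitrary: m)
    case 0
    have "dim_row A = ?N" using A by auto
    then show ?case using x[of m] by simp
  next
    case (Suc n)
    have "((A * B) ^\<^sub>m Suc n) *\<^sub>v x m = ((A * B) ^\<^sub>m n) *\<^sub>v ((A * B) *\<^sub>v x m)"
      using assoc_mult_mat_vec[OF pow_carrier_mat[OF AB, of n] AB x[of m]] by simp
    then show ?case using Suc.IH[of "Suc m"] step by simp
  qed
  from this[of _ 0] have "\<forall>n\<ge>1. ((A * B) ^\<^sub>m n) *\<^sub>v v = f n" by (auto simp: x_def)
  then show ?thesis unfolding N f_def using AB v by blast
qed

end

theorem theorem3:
  fixes G :: "nat ugraph" and k :: nat and Ps :: "nat set set list"
  assumes "simple_graph G" and "vertices G = {1..k}"
    and "distinct Ps" and "set Ps = set_partitions (2 * k)"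
  shows "\<exists>M \<in> carrier_mat (Bell (2 * k)) (Bell (2 * k)). \<exists>v \<in> carrier_vec (Bell (2 * k)).
           \<forall>n\<ge>3. int (num_spanning_trees (cart_prod G (cycle_graph n))) =
                  ((M ^\<^sub>m n) *\<^sub>v v) \<bullet> tree_counting_vector G k Ps"
proof (cases "k = 0")
  case True
  let ?N = "Bell (2 * k)"
  \<comment> \<open>\<open>connected_graph\<close> demands a vertex, so for k = 0 all counts are 0
    and the zero vector serves.\<close>
  have "\<not> spanning_tree T (cart_prod G (cycle_graph n))" for T n
    using True assms(2)
    by (auto simp: spanning_tree_def spanning_subgraph_def is_tree_def connected_graph_def cart_prod_def)
  then have trees: "num_spanning_trees (cart_prod G (cycle_graph n)) = 0" for n
    by (simp add: num_spanning_trees_def)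
  have N: "?N = length Ps" using assms(3,4) by (simp add: Bell_def flip: distinct_card)
  have "((1\<^sub>m ?N ^\<^sub>m n) *\<^sub>v 0\<^sub>v ?N) \<bullet> tree_counting_vector G k Ps = 0" for n
  proof -
    have "1\<^sub>m ?N ^\<^sub>m n \<in> carrier_mat ?N ?N" by (rule pow_carrier_mat) simp
    then have "(1\<^sub>m ?N ^\<^sub>m n) *\<^sub>v 0\<^sub>v ?N = (0\<^sub>v ?N :: int vec)" by auto
    moreover have "tree_counting_vector G k Ps \<in> carrier_vec ?N"
      by (simp add: tree_counting_vector_def N)
    ultimately show ?thesis by simp
  qed
  then show ?thesis unfolding trees
    by (intro bexI[of _ "1\<^sub>m ?N"] bexI[of _ "0\<^sub>v ?N"]) auto
next
  case False
  then interpret labelled_graph G k using assms by unfold_locales auto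
  obtain M v where M: "M \<in> carrier_mat (Bell (2 * k)) (Bell (2 * k))" "v \<in> carrier_vec (Bell (2 * k))"
    and Mv: "\<And>n. n \<ge> 1 \<Longrightarrow>
      (M ^\<^sub>m n) *\<^sub>v v = vec (length Ps) (\<lambda>i. int (full_count n (Ps ! i)))"
    using exists_transfer_matrix[OF assms(3,4)] by blast
  have parts: "{P. partition_on {1..2 * k} P} = set Ps"
    using assms(4) by (simp add: set_partitions_def)
  have "int (num_spanning_trees (cart_prod G (cycle_graph n))) =
      ((M ^\<^sub>m n) *\<^sub>v v) \<bullet> tree_counting_vector G k Ps" if "n \<ge> 3" for n
  proof -
    have "int (num_spanning_trees (cart_prod G (cycle_graph n))) =
        (\<Sum>i<length Ps. int (full_count n (Ps ! i)) * int (tree_count G k (Ps ! i)))"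
      unfolding num_spanning_trees_tree_count[OF that] parts using assms(3)
      by (simp add: sum.distinct_set_conv_list sum_list_sum_nth atLeast0LessThan)
    also have "\<dots> = ((M ^\<^sub>m n) *\<^sub>v v) \<bullet> tree_counting_vector G k Ps"
      using that by (simp add: Mv tree_counting_vector_def scalar_prod_def atLeast0LessThan)
    finally show ?thesis .
  qed
  then show ?thesis using M by blast
qed

end
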